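(* Let $W$ be a standard one-dimensional Brownian motion, let $T>0$, and let $f:\mathbb{R}\to\mathbb{R}$ be bounded. For $\varepsilon>0$ let $Q_\varepsilon(t)=[f(\varepsilon W),\varepsilon W](t)$, $t\in[0,T]$. Suppose that ${\rm osc}_f(\delta)\le C_f\delta^\alpha$ for some $\alpha\in(0,1)$, some $C_f>0$ and all sufficiently small $\delta>0$. Then for every $\delta>0$, $\gamma\in(0,\alpha)$ and $\mu\in(\gamma,\alpha)$ there are constants $\varepsilon_{\delta,\mu}>0$ and $C_{\delta,\mu}>0$ such that \[ \mathsf{P}\Big\{\varepsilon^{-(1+\gamma)}\sup_{t\le T}|Q_\varepsilon(t)|>\delta\Big\}\le C_{\delta,\mu}\,\varepsilon^{2(\alpha-\mu)/(1-\alpha)},\qquad \varepsilon\in(0,\varepsilon_{\delta,\mu}). \] In particular, for any $\gamma\in(0,\alpha)$, $\varepsilon^{-(1+\gamma)}\sup_{t\le T}|Q_\varepsilon(t)|\to 0$ in probability as $\varepsilon\to0$.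
   Context: The modulus of continuity of $f$ is ${\rm osc}_f(\delta)=\sup_{|t-s|<\delta}|f(s)-f(t)|$ for $\delta>0$. The quadratic covariation $[X,Y](t)$ of two processes is the limit in probability, as the mesh of partitions $0=u_0<\dots<u_m=t$ tends to $0$, of $\sum_{k}(X(u_{k+1})-X(u_k))(Y(u_{k+1})-Y(u_k))$. *)

theory Defs
  imports "HOL-Probability.Probability"
begin

definition osc :: "(real \<Rightarrow> real) \<Rightarrow> real \<Rightarrow> real" where
  "osc f d = Sup {\<bar>f s - f t\<bar> | s t. \<bar>t - s\<bar> < d}"

definition brownian_motion :: "'a measure \<Rightarrow> (real \<Rightarrow> 'a \<Rightarrow> real) \<Rightarrow> bool" where
  "brownian_motion M W \<longleftrightarrow>
     prob_space M \<and>
     (\<forall>t\<ge>0. W t \<in> borel_measurable M) \<and>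
     (\<forall>\<omega>\<in>space M. W 0 \<omega> = 0 \<and> continuous_on {0..} (\<lambda>t. W t \<omega>)) \<and>
     (\<forall>s t. 0 \<le> s \<and> s < t \<longrightarrow>
        distributed M lborel (\<lambda>\<omega>. W t \<omega> - W s \<omega>) (normal_density 0 (sqrt (t - s)))) \<and>
     (\<forall>(u::nat \<Rightarrow> real) n. 0 \<le> u 0 \<and> (\<forall>k<n. u k < u (Suc k)) \<longrightarrow>
        prob_space.indep_vars M (\<lambda>_. borel) (\<lambda>k \<omega>. W (u (Suc k)) \<omega> - W (u k) \<omega>) {..<n})"

definition is_partition :: "(nat \<Rightarrow> real) \<Rightarrow> nat \<Rightarrow> real \<Rightarrow> bool" where
  "is_partition u m t \<longleftrightarrow> u 0 = 0 \<and> u m = t \<and> (\<forall>k<m. u k < u (Suc k))"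

definition mesh :: "(nat \<Rightarrow> real) \<Rightarrow> nat \<Rightarrow> real" where
  "mesh u m = Max (insert 0 ((\<lambda>k. u (Suc k) - u k) ` {..<m}))"

definition is_quadratic_covariation ::
  "'a measure \<Rightarrow> (real \<Rightarrow> 'a \<Rightarrow> real) \<Rightarrow> (real \<Rightarrow> 'a \<Rightarrow> real) \<Rightarrow> (real \<Rightarrow> 'a \<Rightarrow> real) \<Rightarrow> real \<Rightarrow> bool"
where
  "is_quadratic_covariation M X Y Q T \<longleftrightarrow>
     (\<forall>t\<in>{0..T}. \<forall>\<eta>>0. \<forall>e>0. \<exists>d>0. \<forall>u m. is_partition u m t \<and> mesh u m < d \<longrightarrow>
        measure M {\<omega>\<in>space M.
          \<bar>(\<Sum>k<m. (X (u (Suc k)) \<omega> - X (u k) \<omega>) * (Y (u (Suc k)) \<omega> - Y (u k) \<omega>)) - Q t \<omega>\<bar> > \<eta>} < e)"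

end

theory Submission
  imports Defs "HOL-Combinatorics.Transposition"
begin

text \<open>
  For every h > 0 the Hoelder function f splits as p + g, where p is Lipschitz with constant
  C h^(\<alpha>-1) and |g| is at most C h^\<alpha>. On a uniform partition the covariation sums of p are bounded by
  C h^(\<alpha>-1) \<epsilon>^2 times the discrete quadratic variation of W, which is close to T. The covariation sums
  of g are the difference of a backward and a forward sum. The forward sum is a martingale; the
  backward sum is, after removal of a drift with second moment of order T, a martingale in
  reversed time. Doob's inequality bounds the maxima of both, with a probability of order
  \<epsilon>^2 h^(2\<alpha>) / z^2 of exceeding z. Taking z of order \<epsilon>^(1+\<gamma>) and h of order \<epsilon>^((1-\<gamma>)/(1-\<alpha>)) makes
  the contribution of p smaller than z and gives the rate \<epsilon>^(2(\<alpha>-\<gamma>)/(1-\<alpha>)). These bounds do not depend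
  on the partition, so they pass to Q on finite grids and, by continuity, to its supremum.
\<close>

section \<open>Second-moment calculus\<close>

definition square_integrable :: "'a measure \<Rightarrow> ('a \<Rightarrow> real) \<Rightarrow> bool" where
  "square_integrable M Z \<longleftrightarrow> Z \<in> borel_measurable M \<and> integrable M (\<lambda>\<omega>. (Z \<omega>)\<^sup>2)"

lemma square_integrable_measurable: "square_integrable M Z \<Longrightarrow> Z \<in> borel_measurable M"
  by (simp add: square_integrable_def)

lemma integrable_mult_square_integrable:
  assumes "square_integrable M Y" "square_integrable M Z"
  shows "integrable M (\<lambda>\<omega>. Y \<omega> * Z \<omega>)"
proof (rule Bochner_Integration.integrable_bound)
  show "integrable M (\<lambda>\<omega>. (Y \<omega>)\<^sup>2 + (Z \<omega>)\<^sup>2)"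
    using assms by (auto simp: square_integrable_def)
  show "(\<lambda>\<omega>. Y \<omega> * Z \<omega>) \<in> borel_measurable M"
    using assms by (auto simp: square_integrable_def)
  have "\<bar>a * b\<bar> \<le> a\<^sup>2 + b\<^sup>2" for a b :: real
    using sum_squares_bound[of "\<bar>a\<bar>" "\<bar>b\<bar>"] abs_ge_zero[of "a * b"] unfolding abs_mult power2_abs
    by linarith
  then show "AE \<omega> in M. norm (Y \<omega> * Z \<omega>) \<le> norm ((Y \<omega>)\<^sup>2 + (Z \<omega>)\<^sup>2)"
    by simp
qed

lemma square_integrable_add:
  assumes "square_integrable M Y" "square_integrable M Z"
  shows "square_integrable M (\<lambda>\<omega>. Y \<omega> + Z \<omega>)"
  using assms integrable_mult_square_integrable[OF assms]
  by (auto simp: square_integrable_def power2_sum mult.assoc)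

lemma square_integrable_cmult:
  "square_integrable M Z \<Longrightarrow> square_integrable M (\<lambda>\<omega>. c * Z \<omega>)"
  by (auto simp: square_integrable_def power_mult_distrib)

lemma square_integrable_diff:
  assumes "square_integrable M Y" "square_integrable M Z"
  shows "square_integrable M (\<lambda>\<omega>. Y \<omega> - Z \<omega>)"
  using square_integrable_add[OF assms(1) square_integrable_cmult[OF assms(2), of "-1"]] by simp

lemma square_integrable_sum:
  "(\<And>i. i \<in> I \<Longrightarrow> square_integrable M (Z i)) \<Longrightarrow> square_integrable M (\<lambda>\<omega>. \<Sum>i\<in>I. Z i \<omega>)"
proof (induction I rule: infinite_finite_induct)
  case (insert i I)
  then show ?case using square_integrable_add[of M "Z i" "\<lambda>\<omega>. \<Sum>i\<in>I. Z i \<omega>"] by simp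
qed (auto simp: square_integrable_def)

lemma square_integrable_mult_bounded:
  assumes Z: "square_integrable M Z" and [measurable]: "G \<in> borel_measurable M"
    and G: "\<And>\<omega>. \<bar>G \<omega>\<bar> \<le> B"
  shows "square_integrable M (\<lambda>\<omega>. G \<omega> * Z \<omega>)"
    and "(\<integral>\<omega>. (G \<omega> * Z \<omega>)\<^sup>2 \<partial>M) \<le> B\<^sup>2 * (\<integral>\<omega>. (Z \<omega>)\<^sup>2 \<partial>M)"
proof -
  have [measurable]: "Z \<in> borel_measurable M" and Z2: "integrable M (\<lambda>\<omega>. (Z \<omega>)\<^sup>2)"
    using Z by (auto simp: square_integrable_def)
  have le: "(G \<omega> * Z \<omega>)\<^sup>2 \<le> B\<^sup>2 * (Z \<omega>)\<^sup>2" for \<omega>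
  proof -
    have "(G \<omega>)\<^sup>2 \<le> B\<^sup>2"
      using power_mono[OF G[of \<omega>] abs_ge_zero, of 2] by simp
    then show ?thesis by (simp add: power_mult_distrib mult_right_mono)
  qed
  have int: "integrable M (\<lambda>\<omega>. (G \<omega> * Z \<omega>)\<^sup>2)"
    by (rule Bochner_Integration.integrable_bound[OF integrable_mult_right[OF Z2, of "B\<^sup>2"]])
       (use le in \<open>auto simp: abs_mult power_mult_distrib\<close>)
  then show "square_integrable M (\<lambda>\<omega>. G \<omega> * Z \<omega>)"
    by (simp add: square_integrable_def)
  have "(\<integral>\<omega>. (G \<omega> * Z \<omega>)\<^sup>2 \<partial>M) \<le> (\<integral>\<omega>. B\<^sup>2 * (Z \<omega>)\<^sup>2 \<partial>M)"
    using int Z2 le by (intro integral_mono) auto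
  then show "(\<integral>\<omega>. (G \<omega> * Z \<omega>)\<^sup>2 \<partial>M) \<le> B\<^sup>2 * (\<integral>\<omega>. (Z \<omega>)\<^sup>2 \<partial>M)"
    by simp
qed

lemma integral_square_add:
  assumes "square_integrable M Y" "square_integrable M Z"
  shows "(\<integral>\<omega>. (Y \<omega> + Z \<omega>)\<^sup>2 \<partial>M) =
    (\<integral>\<omega>. (Y \<omega>)\<^sup>2 \<partial>M) + (\<integral>\<omega>. (Z \<omega>)\<^sup>2 \<partial>M) + 2 * (\<integral>\<omega>. Y \<omega> * Z \<omega> \<partial>M)"
  using assms integrable_mult_square_integrable[OF assms]
  by (simp add: square_integrable_def power2_sum mult.assoc)

text \<open>Pythagoras in L2, by induction: the new term is orthogonal to each earlier one, hence to
  their sum, and the cross term drops out.\<close>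

lemma integral_square_sum_orthogonal:
  fixes n :: nat
  assumes D: "\<And>i. i < n \<Longrightarrow> square_integrable M (D i)"
    and orth: "\<And>i j. j < i \<Longrightarrow> i < n \<Longrightarrow> (\<integral>\<omega>. D j \<omega> * D i \<omega> \<partial>M) = 0"
  shows "(\<integral>\<omega>. (\<Sum>i<n. D i \<omega>)\<^sup>2 \<partial>M) = (\<Sum>i<n. \<integral>\<omega>. (D i \<omega>)\<^sup>2 \<partial>M)"
  using assms
proof (induction n)
  case (Suc n)
  have "(\<integral>\<omega>. (\<Sum>i<n. D i \<omega>) * D n \<omega> \<partial>M) = (\<Sum>i<n. \<integral>\<omega>. D i \<omega> * D n \<omega> \<partial>M)"
    unfolding sum_distrib_right using Suc.prems
    by (intro Bochner_Integration.integral_sum integrable_mult_square_integrable) auto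
  also have "\<dots> = 0" using Suc.prems by simp
  finally have "(\<integral>\<omega>. (\<Sum>i<n. D i \<omega>) * D n \<omega> \<partial>M) = 0" .
  moreover have "square_integrable M (\<lambda>\<omega>. \<Sum>i<n. D i \<omega>)"
    using Suc.prems by (intro square_integrable_sum) auto
  ultimately show ?case
    using Suc by (simp add: integral_square_add)
qed simp

section \<open>A maximal inequality\<close>

text \<open>A sum stopped when its modulus first reaches \<open>x\<close>, written pathwise for a
  sequence \<open>d\<close> of increments. The recursion makes the value at \<open>k\<close> a
  function of the increments before \<open>k\<close>, which takes the place of adaptedness to a
  filtration.\<close>

primrec stopped :: "real \<Rightarrow> (nat \<Rightarrow> real) \<Rightarrow> nat \<Rightarrow> real" where
  "stopped x d 0 = 0"
| "stopped x d (Suc k) = (if \<bar>stopped x d k\<bar> < x then stopped x d k + d k else stopped x d k)"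

lemma stopped_cong: "(\<And>i. i < k \<Longrightarrow> d i = d' i) \<Longrightarrow> stopped x d k = stopped x d' k"
  by (induction k) auto

lemma measurable_stopped:
  "(\<And>i. i < k \<Longrightarrow> (\<lambda>\<omega>. D \<omega> i) \<in> borel_measurable N) \<Longrightarrow>
    (\<lambda>\<omega>. stopped x (D \<omega>) k) \<in> borel_measurable N"
proof (induction k)
  case (Suc k)
  have [measurable]: "(\<lambda>\<omega>. stopped x (D \<omega>) k) \<in> borel_measurable N" "(\<lambda>\<omega>. D \<omega> k) \<in> borel_measurable N"
    using Suc by auto
  show ?case by simp
qed simp

text \<open>Once frozen the value stays frozen, and until then it is the plain sum. The use is: if
  some partial sum up to \<open>k\<close> reaches \<open>x\<close> in modulus, then so does the
  stopped sum at \<open>k\<close>.\<close>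

lemma stopped_dichotomy:
  assumes "x > 0"
  shows "\<bar>stopped x d k\<bar> \<ge> x \<or>
    (\<forall>j\<le>k. \<bar>\<Sum>i<j. d i\<bar> < x) \<and> stopped x d k = (\<Sum>i<k. d i)"
proof (induction k)
  case (Suc k)
  then show ?case
    by (cases "\<bar>stopped x d (Suc k)\<bar> \<ge> x") (auto simp: le_Suc_eq split: if_splits)
qed (use assms in auto)

text \<open>Doob's inequality without filtrations or conditional expectations. The orthogonality in
  \<open>orth\<close> is exactly the vanishing of the cross term in the second moment of the stopped
  sum. That moment is then at most the sum of the second moments of the increments, and Chebyshev's
  inequality applies to the stopped sum at \<open>n\<close>.\<close>

lemma (in finite_measure) maximal_inequality:
  fixes D :: "'a \<Rightarrow> nat \<Rightarrow> real"
  assumes x: "x > 0"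
    and D: "\<And>i. i < n \<Longrightarrow> square_integrable M (\<lambda>\<omega>. D \<omega> i)"
    and orth: "\<And>i. i < n \<Longrightarrow>
      (\<integral>\<omega>. D \<omega> i * (if \<bar>stopped x (D \<omega>) i\<bar> < x then stopped x (D \<omega>) i else 0) \<partial>M) = 0"
  shows "measure M {\<omega>\<in>space M. \<exists>k\<le>n. \<bar>\<Sum>i<k. D \<omega> i\<bar> \<ge> x} \<le> (\<Sum>i<n. \<integral>\<omega>. (D \<omega> i)\<^sup>2 \<partial>M) / x\<^sup>2"
proof -
  let ?T = "\<lambda>k \<omega>. stopped x (D \<omega>) k"
  have "square_integrable M (?T k) \<and> (\<integral>\<omega>. (?T k \<omega>)\<^sup>2 \<partial>M) \<le> (\<Sum>i<k. \<integral>\<omega>. (D \<omega> i)\<^sup>2 \<partial>M)"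
    if "k \<le> n" for k
    using that
  proof (induction k)
    case (Suc k)
    then have T: "square_integrable M (?T k)" by simp
    note [measurable] = square_integrable_measurable[OF this]
    have Dk: "square_integrable M (\<lambda>\<omega>. D \<omega> k)" using D Suc.prems by simp
    note [measurable] = square_integrable_measurable[OF this]
    \<comment> \<open>\<open>?G\<close> indicates that stopping has not yet occurred, so the stopped
      sum grows by \<open>?G\<close> times the increment. Multiplied by the stopped sum, this is the
      integrand in \<open>orth\<close>.\<close>
    let ?G = "\<lambda>\<omega>. (if \<bar>?T k \<omega>\<bar> < x then 1 else 0 :: real)"
    have eq: "?T (Suc k) \<omega> = ?T k \<omega> + ?G \<omega> * D \<omega> k" for \<omega>
      by simp
    have G: "square_integrable M (\<lambda>\<omega>. ?G \<omega> * D \<omega> k)"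
      "(\<integral>\<omega>. (?G \<omega> * D \<omega> k)\<^sup>2 \<partial>M) \<le> (\<integral>\<omega>. (D \<omega> k)\<^sup>2 \<partial>M)"
      using square_integrable_mult_bounded[OF Dk, of ?G 1] by auto
    have "(\<lambda>\<omega>. ?T k \<omega> * (?G \<omega> * D \<omega> k)) = (\<lambda>\<omega>. D \<omega> k * (if \<bar>?T k \<omega>\<bar> < x then ?T k \<omega> else 0))"
      by auto
    then have "(\<integral>\<omega>. ?T k \<omega> * (?G \<omega> * D \<omega> k) \<partial>M) = 0"
      using orth[of k] Suc.prems by simp
    then have "(\<integral>\<omega>. (?T (Suc k) \<omega>)\<^sup>2 \<partial>M) \<le> (\<Sum>i<Suc k. \<integral>\<omega>. (D \<omega> i)\<^sup>2 \<partial>M)"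
      unfolding eq integral_square_add[OF T G(1)] sum.lessThan_Suc
      using G(2) Suc.IH Suc.prems by simp
    moreover have "square_integrable M (?T (Suc k))"
      unfolding eq by (rule square_integrable_add[OF T G(1)])
    ultimately show ?case by blast
  qed (simp add: square_integrable_def)
  then have T: "square_integrable M (?T n)"
    and le: "(\<integral>\<omega>. (?T n \<omega>)\<^sup>2 \<partial>M) \<le> (\<Sum>i<n. \<integral>\<omega>. (D \<omega> i)\<^sup>2 \<partial>M)"
    by auto
  note [measurable] = square_integrable_measurable[OF T]
  have "measure M {\<omega>\<in>space M. \<exists>k\<le>n. \<bar>\<Sum>i<k. D \<omega> i\<bar> \<ge> x} \<le> measure M {\<omega>\<in>space M. \<bar>?T n \<omega>\<bar> \<ge> x}"
    using stopped_dichotomy[OF x] by (intro finite_measure_mono) (auto simp: not_less, metis not_le)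
  also have "\<dots> \<le> (\<integral>\<omega>. (?T n \<omega>)\<^sup>2 \<partial>M) / x\<^sup>2"
    using T x by (intro second_moment_method) (auto simp: square_integrable_def)
  also have "\<dots> \<le> (\<Sum>i<n. \<integral>\<omega>. (D \<omega> i)\<^sup>2 \<partial>M) / x\<^sup>2"
    by (intro divide_right_mono le) simp
  finally show ?thesis .
qed

section \<open>Gaussian random walks\<close>

text \<open>The increments of Brownian motion over a uniform grid of step \<tau>. The index set is
  all of \<open>nat\<close>, so that the joint law is one product measure on sequences, on which
  sign flips and transpositions act.\<close>

locale gaussian_increments = prob_space M for M :: "'a measure" +
  fixes X :: "nat \<Rightarrow> 'a \<Rightarrow> real" and \<tau> :: real
  assumes tau: "\<tau> > 0"
    and indep: "indep_vars (\<lambda>_. borel) X UNIV"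
    and normal: "distributed M lborel (X i) (normal_density 0 (sqrt \<tau>))"
begin

lemma measurable_X [measurable]: "X i \<in> borel_measurable M"
  using distributed_measurable[OF normal[of i]] by simp

lemma distr_X: "distr M borel (X i) = density lborel (normal_density 0 (sqrt \<tau>))"
  using distributed_distr_eq_density[OF normal[of i]] by (metis distr_cong sets_lborel)

text \<open>The joint law of an independent family is the product of its marginals. Through this
  lemma, symmetries of the Gaussian product measure replace conditional expectations.\<close>

lemma integral_eq_of_same_law:
  assumes Y: "indep_vars (\<lambda>_. borel) Y (UNIV :: nat set)"
    and YX: "\<And>i. distr M borel (Y i) = distr M borel (X i)"
    and F [measurable]: "F \<in> borel_measurable (PiM UNIV (\<lambda>_. borel :: real measure))"
  shows "(\<integral>\<omega>. F (\<lambda>i. X i \<omega>) \<partial>M) = (\<integral>\<omega>. (F (\<lambda>i. Y i \<omega>) :: real) \<partial>M)"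
proof -
  have [measurable]: "Y i \<in> borel_measurable M" for i
    using Y by (auto simp: indep_vars_def)
  let ?P = "PiM UNIV (\<lambda>_. borel :: real measure)"
  have "distr M ?P (\<lambda>\<omega> i. X i \<omega>) = PiM UNIV (\<lambda>i. distr M borel (X i))"
    using indep_vars_iff_distr_eq_PiM[where I=UNIV and M'="\<lambda>_. borel" and X=X] indep by (simp add: restrict_def)
  also have "\<dots> = PiM UNIV (\<lambda>i. distr M borel (Y i))"
    by (simp add: YX)
  also have "\<dots> = distr M ?P (\<lambda>\<omega> i. Y i \<omega>)"
    using indep_vars_iff_distr_eq_PiM[where I=UNIV and M'="\<lambda>_. borel" and X=Y] Y by (simp add: restrict_def)
  finally have eq: "distr M ?P (\<lambda>\<omega> i. X i \<omega>) = distr M ?P (\<lambda>\<omega> i. Y i \<omega>)" .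
  have [measurable]: "(\<lambda>\<omega> i. X i \<omega>) \<in> measurable M ?P" "(\<lambda>\<omega> i. Y i \<omega>) \<in> measurable M ?P"
    by (auto intro!: measurable_PiM_single')
  have "(\<integral>\<omega>. F (\<lambda>i. X i \<omega>) \<partial>M) = (\<integral>v. F v \<partial>distr M ?P (\<lambda>\<omega> i. X i \<omega>))"
    by (simp add: integral_distr)
  also have "\<dots> = (\<integral>\<omega>. F (\<lambda>i. Y i \<omega>) \<partial>M)"
    unfolding eq by (simp add: integral_distr)
  finally show ?thesis .
qed

text \<open>The centred normal law is symmetric. Consequently a functional that is odd in one
  coordinate has integral zero, which serves as the martingale property.\<close>

lemma integral_flip_sign:
  assumes "F \<in> borel_measurable (PiM UNIV (\<lambda>_. borel :: real measure))"
  shows "(\<integral>\<omega>. F (\<lambda>i. X i \<omega>) \<partial>M) = (\<integral>\<omega>. (F (\<lambda>i. if i = k then - X i \<omega> else X i \<omega>) :: real) \<partial>M)"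
proof (rule integral_eq_of_same_law[OF _ _ assms])
  show "indep_vars (\<lambda>_. borel) (\<lambda>i \<omega>. if i = k then - X i \<omega> else X i \<omega>) UNIV"
    by (rule indep_vars_compose2[OF indep, where Y="\<lambda>i y. if i = k then - y else y"]) auto
  have "distributed M lborel (\<lambda>\<omega>. - X k \<omega>) (normal_density 0 (sqrt \<tau>))"
    using normal_density_affine[OF normal[of k], of "-1" 0] tau by simp
  then have "distr M borel (\<lambda>\<omega>. - X k \<omega>) = density lborel (normal_density 0 (sqrt \<tau>))"
    using distributed_distr_eq_density by (metis distr_cong sets_lborel)
  then show "distr M borel (\<lambda>\<omega>. if i = k then - X i \<omega> else X i \<omega>) = distr M borel (X i)" for i
    using distr_X by (cases "i = k") auto
qed

text \<open>Exchangeability: a product of identical measures is invariant under a permutation of the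
  coordinates.\<close>

lemma integral_swap:
  assumes "F \<in> borel_measurable (PiM UNIV (\<lambda>_. borel :: real measure))"
  shows "(\<integral>\<omega>. F (\<lambda>i. X i \<omega>) \<partial>M) = (\<integral>\<omega>. (F (\<lambda>i. X (Transposition.transpose a b i) \<omega>) :: real) \<partial>M)"
proof (rule integral_eq_of_same_law[OF _ _ assms])
  let ?P = "PiM UNIV (\<lambda>_. borel :: real measure)" and ?t = "Transposition.transpose a b :: nat \<Rightarrow> nat"
  let ?N = "density lborel (normal_density 0 (sqrt \<tau>))"
  interpret N: prob_space ?N
    using tau by (intro prob_space_normal_density) simp
  have [measurable]: "(\<lambda>\<omega> i. X i \<omega>) \<in> measurable M ?P" "(\<lambda>v i. v (?t i)) \<in> measurable ?P ?P"
    by (auto intro!: measurable_PiM_single')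
  have X: "distr M ?P (\<lambda>\<omega> i. X i \<omega>) = PiM UNIV (\<lambda>i. ?N)"
    using indep_vars_iff_distr_eq_PiM[where I=UNIV and M'="\<lambda>_. borel" and X=X] indep by (simp add: restrict_def distr_X)
  have "distr M ?P (\<lambda>\<omega> i. X (?t i) \<omega>) = distr (distr M ?P (\<lambda>\<omega> i. X i \<omega>)) ?P (\<lambda>v i. v (?t i))"
    by (simp add: distr_distr comp_def)
  also have "\<dots> = distr (PiM UNIV (\<lambda>i. ?N)) (PiM UNIV (\<lambda>i. ?N)) (\<lambda>v i. v (?t i))"
    unfolding X by (intro distr_cong sets_PiM_cong) auto
  also have "\<dots> = PiM UNIV (\<lambda>i. ?N)"
    using distr_PiM_reindex[of UNIV "\<lambda>_. ?N" ?t UNIV] N.prob_space_axioms by (simp add: restrict_def)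
  finally show "indep_vars (\<lambda>_. borel) (\<lambda>i. X (?t i)) UNIV"
    using indep_vars_iff_distr_eq_PiM[where I=UNIV and M'="\<lambda>_. borel" and X="\<lambda>i. X (?t i)"]
    by (simp add: restrict_def distr_X)
qed (simp add: distr_X)

lemma integrable_X_power: "integrable M (\<lambda>\<omega>. X i \<omega> ^ k)"
  using distributed_integrable[OF normal[of i], of "\<lambda>x. x ^ k"] integrable_normal_moment[of "sqrt \<tau>" 0 k] tau
  by simp

lemma expectation_X_power: "expectation (\<lambda>\<omega>. X i \<omega> ^ k) = (\<integral>x. normal_density 0 (sqrt \<tau>) x * x ^ k \<partial>lborel)"
  using distributed_integral[OF normal[of i], of "\<lambda>x. x ^ k"] by simp

lemma second_moment_X: "expectation (\<lambda>\<omega>. (X i \<omega>)\<^sup>2) = \<tau>"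
  using integral_normal_moment_even[of "sqrt \<tau>" 0 1] tau by (simp add: expectation_X_power)

lemma fourth_moment_X: "expectation (\<lambda>\<omega>. X i \<omega> ^ 4) = 3 * \<tau>\<^sup>2"
  using integral_normal_moment_even[of "sqrt \<tau>" 0 2] tau
  by (simp add: expectation_X_power fact_numeral field_simps)

lemma square_integrable_X: "square_integrable M (X i)"
  using integrable_X_power[of i 2] by (simp add: square_integrable_def)

lemma orthogonal_X: "i \<noteq> j \<Longrightarrow> expectation (\<lambda>\<omega>. X i \<omega> * X j \<omega>) = 0"
  using integral_flip_sign[of "\<lambda>v. v i * v j" i] by simp

text \<open>For Brownian increments this is the value of W at time k * \<tau>.\<close>

definition walk :: "nat \<Rightarrow> 'a \<Rightarrow> real" where
  "walk k \<omega> = (\<Sum>i<k. X i \<omega>)"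

lemma measurable_walk [measurable]: "walk k \<in> borel_measurable M"
  unfolding walk_def by measurable

lemma square_integrable_walk: "square_integrable M (walk k)"
  unfolding walk_def by (intro square_integrable_sum square_integrable_X)

lemma second_moment_walk: "expectation (\<lambda>\<omega>. (walk k \<omega>)\<^sup>2) = k * \<tau>"
  unfolding walk_def
  by (subst integral_square_sum_orthogonal) (auto simp: square_integrable_X orthogonal_X second_moment_X)

text \<open>Chebyshev's inequality for the centred squares \<open>U\<close>. They are orthogonal
  with second moment 2 * \<tau>^2, so their sum has second moment 2 * n * \<tau>^2 and exceeds n *
  \<tau> with probability at most 2 / n. The bound vanishes under refinement of the grid.\<close>

lemma prob_quadratic_variation_le:
  assumes "n > 0"
  shows "prob {\<omega>\<in>space M. (\<Sum>i<n. (X i \<omega>)\<^sup>2) \<ge> 2 * real n * \<tau>} \<le> 2 / n"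
proof -
  define U where "U = (\<lambda>i \<omega>. (X i \<omega>)\<^sup>2 - \<tau>)"
  have [measurable]: "U i \<in> borel_measurable M" for i
    unfolding U_def by measurable
  have U2: "(U i \<omega>)\<^sup>2 = X i \<omega> ^ 4 - 2 * \<tau> * (X i \<omega>)\<^sup>2 + \<tau>\<^sup>2" for i \<omega>
    unfolding U_def by (simp add: power2_eq_square power4_eq_xxxx algebra_simps)
  have int2: "integrable M (\<lambda>\<omega>. (U i \<omega>)\<^sup>2)" for i
    unfolding U2 by (intro Bochner_Integration.integrable_add Bochner_Integration.integrable_diff
        integrable_mult_right integrable_X_power integrable_const)
  then have U: "square_integrable M (U i)" for i
    by (simp add: square_integrable_def)
  have intU: "integrable M (U i)" for i
    unfolding U_def by (intro Bochner_Integration.integrable_diff integrable_X_power integrable_const)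
  have EU: "expectation (U i) = 0" for i
    unfolding U_def by (simp add: integrable_X_power second_moment_X prob_space)
  have EU2: "expectation (\<lambda>\<omega>. (U i \<omega>)\<^sup>2) = 2 * \<tau>\<^sup>2" for i
    unfolding U2
    by (simp add: integrable_X_power second_moment_X fourth_moment_X prob_space)
       (simp add: power2_eq_square)
  have "indep_vars (\<lambda>_. borel) U UNIV"
    unfolding U_def by (rule indep_vars_compose2[OF indep, where Y="\<lambda>i y. y\<^sup>2 - \<tau>"]) auto
  then have orth: "expectation (\<lambda>\<omega>. U j \<omega> * U i \<omega>) = 0" if "j < i" for i j
    using indep_vars_lebesgue_integral[of "{i, j}" U] indep_vars_subset[of "\<lambda>_. borel" U UNIV "{i, j}"]
      that intU EU by (simp add: mult.commute)
  have "prob {\<omega>\<in>space M. (\<Sum>i<n. (X i \<omega>)\<^sup>2) \<ge> 2 * real n * \<tau>}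
      \<le> prob {\<omega>\<in>space M. \<bar>\<Sum>i<n. U i \<omega>\<bar> \<ge> n * \<tau>}"
    by (intro finite_measure_mono) (auto simp: U_def sum_subtractf)
  also have "\<dots> \<le> expectation (\<lambda>\<omega>. (\<Sum>i<n. U i \<omega>)\<^sup>2) / (n * \<tau>)\<^sup>2"
    using assms tau square_integrable_sum[of "{..<n}" M U] U
    by (intro second_moment_method) (auto simp: square_integrable_def)
  also have "expectation (\<lambda>\<omega>. (\<Sum>i<n. U i \<omega>)\<^sup>2) = n * (2 * \<tau>\<^sup>2)"
    by (subst integral_square_sum_orthogonal) (auto simp: U orth EU2)
  also have "n * (2 * \<tau>\<^sup>2) / (n * \<tau>)\<^sup>2 = 2 / n"
    using assms tau by (simp add: power2_eq_square field_simps)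
  finally show ?thesis .
qed

text \<open>The integrand is evaluated at the left end point. So the i-th term is odd in the i-th
  increment while the earlier terms do not involve it, and the sign flip gives the orthogonality
  needed for the maximal inequality.\<close>

lemma maximal_forward:
  assumes [measurable]: "g \<in> borel_measurable borel" and g: "\<And>y. \<bar>g y\<bar> \<le> B" and x: "x > 0"
  shows "prob {\<omega>\<in>space M. \<exists>k\<le>n. \<bar>\<Sum>i<k. g (walk i \<omega>) * X i \<omega>\<bar> \<ge> x} \<le> B\<^sup>2 * n * \<tau> / x\<^sup>2"
proof -
  \<comment> \<open>The terms are functions of the whole sequence of increments, so that the flip
    can be applied to the argument \<open>v\<close>.\<close>
  define d where "d = (\<lambda>(v :: nat \<Rightarrow> real) i. g (\<Sum>j<i. v j) * v i)"
  let ?D = "\<lambda>\<omega>. d (\<lambda>i. X i \<omega>)"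
  have D: "square_integrable M (\<lambda>\<omega>. ?D \<omega> i)" "expectation (\<lambda>\<omega>. (?D \<omega> i)\<^sup>2) \<le> B\<^sup>2 * \<tau>" for i
    using square_integrable_mult_bounded[OF square_integrable_X[of i], of "\<lambda>\<omega>. g (walk i \<omega>)" B] g
    by (simp_all add: d_def walk_def[symmetric] second_moment_X)
  have [measurable]: "(\<lambda>v. d v i) \<in> borel_measurable (PiM UNIV (\<lambda>_. borel :: real measure))" for i
    unfolding d_def by measurable
  have [measurable]: "(\<lambda>v. stopped x (d v) i) \<in> borel_measurable (PiM UNIV (\<lambda>_. borel :: real measure))" for i
    by (rule measurable_stopped) measurable
  have orth: "expectation (\<lambda>\<omega>. ?D \<omega> i * (if \<bar>stopped x (?D \<omega>) i\<bar> < x then stopped x (?D \<omega>) i else 0)) = 0" for i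
  proof -
    define F where "F = (\<lambda>v. d v i * (if \<bar>stopped x (d v) i\<bar> < x then stopped x (d v) i else 0))"
    have [measurable]: "F \<in> borel_measurable (PiM UNIV (\<lambda>_. borel :: real measure))"
      unfolding F_def by measurable
    \<comment> \<open>Flipping the i-th coordinate leaves the stopped sum at \<open>i\<close>
      unchanged and negates the i-th term.\<close>
    have "F (\<lambda>j. if j = i then - v j else v j) = - F v" for v
    proof -
      let ?v = "\<lambda>j. if j = i then - v j else v j"
      have "d ?v j = d v j" if "j < i" for j
        using that by (simp add: d_def)
      then have "stopped x (d ?v) i = stopped x (d v) i"
        by (rule stopped_cong)
      moreover have "d ?v i = - d v i"
        by (simp add: d_def)
      ultimately show ?thesis
        by (simp add: F_def)
    qed
    then have "expectation (\<lambda>\<omega>. F (\<lambda>j. X j \<omega>)) = - expectation (\<lambda>\<omega>. F (\<lambda>j. X j \<omega>))"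
      using integral_flip_sign[of F i] by simp
    then show ?thesis by (simp add: F_def)
  qed
  have "prob {\<omega>\<in>space M. \<exists>k\<le>n. \<bar>\<Sum>i<k. ?D \<omega> i\<bar> \<ge> x} \<le> (\<Sum>i<n. expectation (\<lambda>\<omega>. (?D \<omega> i)\<^sup>2)) / x\<^sup>2"
    by (rule maximal_inequality[OF x D(1) orth])
  also have "\<dots> \<le> (\<Sum>i<n. B\<^sup>2 * \<tau>) / x\<^sup>2"
    by (intro divide_right_mono sum_mono D(2)) simp
  finally show ?thesis
    by (simp add: d_def walk_def mult_ac)
qed

section \<open>Backward sums: exchangeability and drift\<close>

text \<open>Given the walk from time k + 1 on, the increments up to time k are exchangeable, so each of
  them has conditional mean equal to their average. This replaces the time reversal of Brownian
  motion, whose drift is W(s)/s.\<close>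

lemma expectation_exchangeable:
  assumes [measurable]: "H \<in> borel_measurable (PiM UNIV (\<lambda>_. borel :: real measure))"
    and H: "square_integrable M (\<lambda>\<omega>. H (\<lambda>i. X i \<omega>))"
    and inv: "\<And>v a. a \<le> k \<Longrightarrow> H (\<lambda>i. v (Transposition.transpose a k i)) = H v"
  shows "expectation (\<lambda>\<omega>. (X k \<omega> - walk (Suc k) \<omega> / Suc k) * H (\<lambda>i. X i \<omega>)) = 0"
proof -
  let ?H = "\<lambda>\<omega>. H (\<lambda>i. X i \<omega>)"
  have int: "integrable M (\<lambda>\<omega>. X a \<omega> * ?H \<omega>)" for a
    by (rule integrable_mult_square_integrable[OF square_integrable_X H])
  have eq: "expectation (\<lambda>\<omega>. X a \<omega> * ?H \<omega>) = expectation (\<lambda>\<omega>. X k \<omega> * ?H \<omega>)" if "a \<le> k" for a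
  proof -
    have "H (\<lambda>i. X (Transposition.transpose a k i) \<omega>) = ?H \<omega>" for \<omega>
      by (rule inv[OF that])
    then show ?thesis
      using integral_swap[of "\<lambda>v. v a * H v" a k] by simp
  qed
  have "expectation (\<lambda>\<omega>. walk (Suc k) \<omega> * ?H \<omega>) = (\<Sum>a<Suc k. expectation (\<lambda>\<omega>. X a \<omega> * ?H \<omega>))"
    unfolding walk_def sum_distrib_right by (rule Bochner_Integration.integral_sum) (rule int)
  also have "\<dots> = (\<Sum>a<Suc k. expectation (\<lambda>\<omega>. X k \<omega> * ?H \<omega>))"
    by (intro sum.cong refl eq) auto
  finally have "expectation (\<lambda>\<omega>. walk (Suc k) \<omega> * ?H \<omega>) = Suc k * expectation (\<lambda>\<omega>. X k \<omega> * ?H \<omega>)"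
    by simp
  moreover have "integrable M (\<lambda>\<omega>. walk (Suc k) \<omega> * ?H \<omega>)"
    by (rule integrable_mult_square_integrable[OF square_integrable_walk H])
  ultimately show ?thesis
    using int[of k] by (simp add: left_diff_distrib del: of_nat_Suc)
qed

end

lemma sum_transpose_lessThan:
  fixes m :: nat and v :: "nat \<Rightarrow> real"
  assumes "a < m" "b < m"
  shows "(\<Sum>i<m. v (Transposition.transpose a b i)) = (\<Sum>i<m. v i)"
  using assms
  by (intro sum.reindex_bij_witness[of _ "Transposition.transpose a b" "Transposition.transpose a b"])
     (auto simp: Transposition.transpose_def)

text \<open>Comparison with a telescoping sum: 1 / sqrt (n + 1) is at most 2 * (sqrt (n + 1) - sqrt
  n).\<close>

lemma sum_inverse_sqrt_le: "(\<Sum>i<n. 1 / sqrt (Suc i)) \<le> 2 * sqrt n"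
proof (induction n)
  case (Suc n)
  have "1 / sqrt (Suc n) \<le> 2 * (sqrt (Suc n) - sqrt n)"
  proof -
    have "(sqrt (Suc n) - sqrt n) * (sqrt (Suc n) + sqrt n) = 1"
      by (simp add: algebra_simps)
    moreover have "(sqrt (Suc n) - sqrt n) * (sqrt (Suc n) + sqrt n) \<le> (sqrt (Suc n) - sqrt n) * (2 * sqrt (Suc n))"
      by (intro mult_left_mono) auto
    ultimately show ?thesis
      by (simp add: divide_simps algebra_simps del: of_nat_Suc real_sqrt_mult_self)
  qed
  then show ?case using Suc by simp
qed simp

context gaussian_increments begin

text \<open>The sum discretises the integral of |W(s)| / s. Cauchy-Schwarz is used with weights;
  unweighted, it would lose a factor of order log n.\<close>

lemma second_moment_drift_le:
  shows "square_integrable M (\<lambda>\<omega>. \<Sum>i<n. \<bar>walk (Suc i) \<omega>\<bar> / Suc i)"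
    and "expectation (\<lambda>\<omega>. (\<Sum>i<n. \<bar>walk (Suc i) \<omega>\<bar> / Suc i)\<^sup>2) \<le> 4 * real n * \<tau>"
proof -
  have absw: "square_integrable M (\<lambda>\<omega>. \<bar>walk (Suc i) \<omega>\<bar> / Suc i)" for i
    using square_integrable_walk[of "Suc i"] by (simp add: square_integrable_def power_divide)
  show si: "square_integrable M (\<lambda>\<omega>. \<Sum>i<n. \<bar>walk (Suc i) \<omega>\<bar> / Suc i)"
    by (intro square_integrable_sum absw)
  \<comment> \<open>With c(i)^2 = 1 / (i + 1), each term is sqrt(c) times c^(3/2) |walk|. As walk(i
    + 1) has second moment (i + 1) * \<tau> = \<tau> / c(i)^2, Cauchy-Schwarz leaves \<tau> times
    the square of the sum of the c(i).\<close>
  define c where "c = (\<lambda>i. 1 / sqrt (Suc i))"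
  have c: "c i > 0" for i by (simp add: c_def)
  have c2: "c i * c i = 1 / Suc i" for i by (simp add: c_def)
  have le: "(\<Sum>i<n. \<bar>walk (Suc i) \<omega>\<bar> / Suc i)\<^sup>2 \<le> (\<Sum>i<n. c i) * (\<Sum>i<n. c i ^ 3 * (walk (Suc i) \<omega>)\<^sup>2)" for \<omega>
  proof -
    have "(\<Sum>i<n. \<bar>walk (Suc i) \<omega>\<bar> / Suc i) = (\<Sum>i<n. sqrt (c i) * (sqrt (c i) * c i * \<bar>walk (Suc i) \<omega>\<bar>))"
      using c by (intro sum.cong refl) (simp add: mult.assoc[symmetric] c2 less_imp_le)
    moreover have "(sqrt (c i) * c i * \<bar>walk (Suc i) \<omega>\<bar>)\<^sup>2 = c i ^ 3 * (walk (Suc i) \<omega>)\<^sup>2" for i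
      using c[of i] by (simp add: power_mult_distrib power3_eq_cube power2_eq_square[of "c i"])
    ultimately show ?thesis
      using Cauchy_Schwarz_ineq_sum[of "\<lambda>i. sqrt (c i)" "\<lambda>i. sqrt (c i) * c i * \<bar>walk (Suc i) \<omega>\<bar>" "{..<n}"] c
      by (simp add: less_imp_le)
  qed
  have int: "integrable M (\<lambda>\<omega>. (walk i \<omega>)\<^sup>2)" for i
    using square_integrable_walk[of i] by (simp add: square_integrable_def)
  have "expectation (\<lambda>\<omega>. (\<Sum>i<n. \<bar>walk (Suc i) \<omega>\<bar> / Suc i)\<^sup>2)
      \<le> expectation (\<lambda>\<omega>. (\<Sum>i<n. c i) * (\<Sum>i<n. c i ^ 3 * (walk (Suc i) \<omega>)\<^sup>2))"
    using si le by (intro integral_mono) (auto simp: square_integrable_def intro!: int)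
  also have "\<dots> = (\<Sum>i<n. c i) * (\<Sum>i<n. c i ^ 3 * (Suc i * \<tau>))"
    by (simp add: int second_moment_walk del: of_nat_Suc)
  also have "(\<Sum>i<n. c i ^ 3 * (Suc i * \<tau>)) = (\<Sum>i<n. c i * \<tau>)"
    by (intro sum.cong refl) (simp add: power3_eq_cube c2 mult.assoc[symmetric])
  also have "(\<Sum>i<n. c i) * (\<Sum>i<n. c i * \<tau>) = (\<Sum>i<n. c i)\<^sup>2 * \<tau>"
    by (simp add: sum_distrib_right[symmetric] power2_eq_square)
  also have "\<dots> \<le> (2 * sqrt n)\<^sup>2 * \<tau>"
    using tau sum_inverse_sqrt_le[of n] c
    by (intro mult_right_mono power_mono) (auto simp: c_def intro!: sum_nonneg)
  finally show "expectation (\<lambda>\<omega>. (\<Sum>i<n. \<bar>walk (Suc i) \<omega>\<bar> / Suc i)\<^sup>2) \<le> 4 * real n * \<tau>"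
    by (simp add: power_mult_distrib)
qed

text \<open>Read from the last term to the first, the centred sum satisfies the orthogonality of the
  maximal inequality, by exchangeability. An initial segment is the difference of two such reversed
  sums, hence the threshold 2 * x. The factor 4 comes from the second moment of one centred
  increment.\<close>

lemma maximal_backward_martingale:
  assumes [measurable]: "g \<in> borel_measurable borel" and g: "\<And>y. \<bar>g y\<bar> \<le> B" and x: "x > 0"
  shows "prob {\<omega>\<in>space M. \<exists>k\<le>n. \<bar>\<Sum>i<k. g (walk (Suc i) \<omega>) * (X i \<omega> - walk (Suc i) \<omega> / Suc i)\<bar> \<ge> 2 * x}
    \<le> 4 * B\<^sup>2 * n * \<tau> / x\<^sup>2"
proof -
  let ?P = "PiM UNIV (\<lambda>_. borel :: real measure)"
  define s where "s = (\<lambda>k (v :: nat \<Rightarrow> real). \<Sum>i<Suc k. v i)"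
  define c where "c = (\<lambda>v k. g (s k v) * (v k - s k v / Suc k))"
  \<comment> \<open>The terms in reversed order, so that those preceding the term with index
    \<open>k\<close> in \<open>d\<close> have indices greater than \<open>k\<close> in
    \<open>c\<close>.\<close>
  define d where "d = (\<lambda>v j. c v (n - Suc j))"
  let ?C = "\<lambda>\<omega>. c (\<lambda>i. X i \<omega>)" and ?D = "\<lambda>\<omega>. d (\<lambda>i. X i \<omega>)"
  have sX: "s k (\<lambda>i. X i \<omega>) = walk (Suc k) \<omega>" for k \<omega>
    by (simp add: s_def walk_def)
  have [measurable]: "s k \<in> borel_measurable ?P" for k
    unfolding s_def by measurable
  have [measurable]: "(\<lambda>v. d v i) \<in> borel_measurable ?P" for i
    unfolding d_def c_def by measurable
  have [measurable]: "(\<lambda>v. stopped x (d v) i) \<in> borel_measurable ?P" for i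
    by (rule measurable_stopped) measurable
  have XP [measurable]: "(\<lambda>\<omega> i. X i \<omega>) \<in> measurable M ?P"
    by (auto intro!: measurable_PiM_single')
  have C: "square_integrable M (\<lambda>\<omega>. ?C \<omega> k)" "expectation (\<lambda>\<omega>. (?C \<omega> k)\<^sup>2) \<le> B\<^sup>2 * (4 * \<tau>)" for k
  proof -
    let ?Z = "\<lambda>\<omega>. X k \<omega> - walk (Suc k) \<omega> / Suc k"
    have w: "square_integrable M (\<lambda>\<omega>. walk (Suc k) \<omega> / Suc k)"
      using square_integrable_walk[of "Suc k"] by (simp add: square_integrable_def power_divide)
    have Z: "square_integrable M ?Z"
      by (rule square_integrable_diff[OF square_integrable_X w])
    note b = square_integrable_mult_bounded[OF Z, of "\<lambda>\<omega>. g (walk (Suc k) \<omega>)" B]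
    show "square_integrable M (\<lambda>\<omega>. ?C \<omega> k)"
      using b(1) g by (simp add: c_def sX)
    \<comment> \<open>The inequality (a - b)^2 <= 2 a^2 + 2 b^2; the average of the first k + 1
      increments has second moment \<tau> / (k + 1), at most \<tau>.\<close>
    have "(?Z \<omega>)\<^sup>2 \<le> 2 * (X k \<omega>)\<^sup>2 + 2 * (walk (Suc k) \<omega> / Suc k)\<^sup>2" for \<omega>
      using zero_le_power2[of "X k \<omega> + walk (Suc k) \<omega> / Suc k"] by (simp add: power2_sum power2_diff)
    then have "expectation (\<lambda>\<omega>. (?Z \<omega>)\<^sup>2) \<le> expectation (\<lambda>\<omega>. 2 * (X k \<omega>)\<^sup>2 + 2 * (walk (Suc k) \<omega> / Suc k)\<^sup>2)"
      using Z w square_integrable_X[of k] by (intro integral_mono) (auto simp: square_integrable_def)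
    also have "\<dots> = 2 * \<tau> + 2 * (Suc k * \<tau> / (Suc k)\<^sup>2)"
    proof -
      have "expectation (\<lambda>\<omega>. (walk (Suc k) \<omega> / Suc k)\<^sup>2) = Suc k * \<tau> / (Suc k)\<^sup>2"
        by (simp add: power_divide second_moment_walk del: of_nat_Suc)
      then show ?thesis
        using w square_integrable_X[of k] by (simp add: square_integrable_def second_moment_X)
    qed
    also have "\<dots> \<le> 4 * \<tau>"
      using tau by (simp add: power2_eq_square divide_simps)
    finally have "expectation (\<lambda>\<omega>. (?Z \<omega>)\<^sup>2) \<le> 4 * \<tau>" .
    then have "B\<^sup>2 * expectation (\<lambda>\<omega>. (?Z \<omega>)\<^sup>2) \<le> B\<^sup>2 * (4 * \<tau>)"
      by (intro mult_left_mono) auto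
    then show "expectation (\<lambda>\<omega>. (?C \<omega> k)\<^sup>2) \<le> B\<^sup>2 * (4 * \<tau>)"
      using b(2) g unfolding c_def sX by fastforce
  qed
  have orth: "expectation (\<lambda>\<omega>. ?D \<omega> i * (if \<bar>stopped x (?D \<omega>) i\<bar> < x then stopped x (?D \<omega>) i else 0)) = 0"
    if "i < n" for i
  proof -
    define k where "k = n - Suc i"
    define Z where "Z = (\<lambda>v. if \<bar>stopped x (d v) i\<bar> < x then stopped x (d v) i else 0)"
    have [measurable]: "Z \<in> borel_measurable ?P"
      unfolding Z_def by measurable
    \<comment> \<open>The cofactor of the centred increment in the orthogonality relation. It
      depends only on the walk from time k + 1 on.\<close>
    define H where "H = (\<lambda>v. g (s k v) * Z v)"
    have [measurable]: "H \<in> borel_measurable ?P"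
      unfolding H_def by measurable
    have [measurable]: "(\<lambda>\<omega>. H (\<lambda>i. X i \<omega>)) \<in> borel_measurable M"
      by (rule measurable_compose[OF XP]) measurable
    have "\<bar>Z v\<bar> \<le> x" for v
      using x by (auto simp: Z_def)
    then have "\<bar>H v\<bar> \<le> B * x" for v
      unfolding H_def abs_mult using g[of 0] by (intro mult_mono g) auto
    then have "square_integrable M (\<lambda>\<omega>. H (\<lambda>i. X i \<omega>))"
      using square_integrable_mult_bounded(1)[of M "\<lambda>_. 1" "\<lambda>\<omega>. H (\<lambda>i. X i \<omega>)" "B * x"]
      by (simp add: square_integrable_def)
    \<comment> \<open>Swapping two increments with indices at most \<open>k\<close> changes neither
      the partial sums of the first m + 1 increments, m >= k, nor the increments after
      \<open>k\<close>; the terms met before the i-th reversed one are built from these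
      alone.\<close>
    moreover have "H (\<lambda>i. v (Transposition.transpose a k i)) = H v" if a: "a \<le> k" for v a
    proof -
      let ?v = "\<lambda>i. v (Transposition.transpose a k i)"
      have s: "s m ?v = s m v" if "k \<le> m" for m
        using sum_transpose_lessThan[of a "Suc m" k v] a that by (simp add: s_def)
      have "d ?v j = d v j" if "j < i" for j
      proof -
        have "k < n - Suc j"
          using that \<open>i < n\<close> by (auto simp: k_def)
        then show ?thesis
          using a s[of "n - Suc j"] by (simp add: d_def c_def Transposition.transpose_def)
      qed
      then have "stopped x (d ?v) i = stopped x (d v) i"
        by (rule stopped_cong)
      then show ?thesis
        by (simp add: H_def Z_def s)
    qed
    ultimately have "expectation (\<lambda>\<omega>. (X k \<omega> - walk (Suc k) \<omega> / Suc k) * H (\<lambda>i. X i \<omega>)) = 0"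
      by (intro expectation_exchangeable) auto
    then show ?thesis
      by (simp add: H_def Z_def d_def c_def sX k_def[symmetric] mult_ac)
  qed
  \<comment> \<open>The first \<open>k\<close> terms are the full reversed sum minus its first
    \<open>n - k\<close> terms.\<close>
  have rev: "(\<Sum>i<k. c v i) = (\<Sum>j<n. d v j) - (\<Sum>j<n - k. d v j)" if "k \<le> n" for k v
  proof -
    have "(\<Sum>j<n - k. d v j) = (\<Sum>i=k..<n. c v i)"
      unfolding d_def
      by (rule sum.reindex_bij_witness[of _ "\<lambda>i. n - Suc i" "\<lambda>i. n - Suc i"]) auto
    moreover have "(\<Sum>j<n. d v j) = (\<Sum>i<n. c v i)"
      unfolding d_def by (rule sum.nat_diff_reindex)
    moreover have "(\<Sum>i<n. c v i) = (\<Sum>i<k. c v i) + (\<Sum>i=k..<n. c v i)"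
      using that sum.atLeastLessThan_concat[of 0 k n "c v"] by (simp add: atLeast0LessThan)
    ultimately show ?thesis by simp
  qed
  have "prob {\<omega>\<in>space M. \<exists>k\<le>n. \<bar>\<Sum>i<k. ?C \<omega> i\<bar> \<ge> 2 * x}
      \<le> prob {\<omega>\<in>space M. \<exists>k\<le>n. \<bar>\<Sum>i<k. ?D \<omega> i\<bar> \<ge> x}"
  proof (rule finite_measure_mono)
    show "{\<omega>\<in>space M. \<exists>k\<le>n. \<bar>\<Sum>i<k. ?C \<omega> i\<bar> \<ge> 2 * x} \<subseteq> {\<omega>\<in>space M. \<exists>k\<le>n. \<bar>\<Sum>i<k. ?D \<omega> i\<bar> \<ge> x}"
    proof safe
      fix \<omega> k assume k: "k \<le> n" "\<bar>\<Sum>i<k. ?C \<omega> i\<bar> \<ge> 2 * x"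
      then have "\<bar>\<Sum>i<n. ?D \<omega> i\<bar> \<ge> x \<or> \<bar>\<Sum>i<n - k. ?D \<omega> i\<bar> \<ge> x"
        unfolding rev[OF k(1)] by arith
      then show "\<exists>k\<le>n. \<bar>\<Sum>i<k. ?D \<omega> i\<bar> \<ge> x"
        by (metis diff_le_self le_refl)
    qed
    have [measurable]: "(\<lambda>\<omega>. ?D \<omega> i) \<in> borel_measurable M" for i
      by (rule measurable_compose[OF XP]) measurable
    show "{\<omega>\<in>space M. \<exists>k\<le>n. \<bar>\<Sum>i<k. ?D \<omega> i\<bar> \<ge> x} \<in> sets M"
      by measurable
  qed
  also have "\<dots> \<le> (\<Sum>i<n. expectation (\<lambda>\<omega>. (?D \<omega> i)\<^sup>2)) / x\<^sup>2"
    using C(1) by (intro maximal_inequality[OF x _ orth]) (auto simp: d_def)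
  also have "\<dots> \<le> (\<Sum>i<n. B\<^sup>2 * (4 * \<tau>)) / x\<^sup>2"
    using C(2) by (intro divide_right_mono sum_mono) (auto simp: d_def)
  finally show ?thesis
    by (simp add: c_def sX mult_ac)
qed

text \<open>The threshold 3 * x is shared as 2 * x for the reversed martingale and x for the drift.
  The drift is dominated for all k <= n at once by B times the sum of |walk| / (i + 1), so
  Chebyshev's inequality at \<open>n\<close> suffices. Each part contributes 4 * B^2 * n * \<tau> /
  x^2.\<close>

lemma maximal_backward:
  assumes [measurable]: "g \<in> borel_measurable borel" and g: "\<And>y. \<bar>g y\<bar> \<le> B" and x: "x > 0"
  shows "prob {\<omega>\<in>space M. \<exists>k\<le>n. \<bar>\<Sum>i<k. g (walk (Suc i) \<omega>) * X i \<omega>\<bar> \<ge> 3 * x} \<le> 8 * B\<^sup>2 * n * \<tau> / x\<^sup>2"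
proof -
  let ?D = "\<lambda>\<omega>. \<Sum>i<n. \<bar>walk (Suc i) \<omega>\<bar> / Suc i"
  let ?R = "\<lambda>k \<omega>. \<Sum>i<k. g (walk (Suc i) \<omega>) * (X i \<omega> - walk (Suc i) \<omega> / Suc i)"
  let ?A1 = "{\<omega>\<in>space M. \<exists>k\<le>n. \<bar>?R k \<omega>\<bar> \<ge> 2 * x}"
  let ?A2 = "{\<omega>\<in>space M. \<bar>B * ?D \<omega>\<bar> \<ge> x}"
  have B: "B \<ge> 0" using g[of 0] by simp
  have "prob {\<omega>\<in>space M. \<exists>k\<le>n. \<bar>\<Sum>i<k. g (walk (Suc i) \<omega>) * X i \<omega>\<bar> \<ge> 3 * x} \<le> prob (?A1 \<union> ?A2)"
  proof (rule finite_measure_mono)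
    show "{\<omega>\<in>space M. \<exists>k\<le>n. \<bar>\<Sum>i<k. g (walk (Suc i) \<omega>) * X i \<omega>\<bar> \<ge> 3 * x} \<subseteq> ?A1 \<union> ?A2"
    proof safe
      fix \<omega> k
      assume \<omega>: "\<omega> \<in> space M" and k: "k \<le> n" "\<bar>\<Sum>i<k. g (walk (Suc i) \<omega>) * X i \<omega>\<bar> \<ge> 3 * x"
        and "\<not> x \<le> \<bar>B * ?D \<omega>\<bar>"
      then have "B * ?D \<omega> < x" by simp
      have "(\<Sum>i<k. g (walk (Suc i) \<omega>) * X i \<omega>) = ?R k \<omega> + (\<Sum>i<k. g (walk (Suc i) \<omega>) * (walk (Suc i) \<omega> / Suc i))"
        by (simp add: sum.distrib[symmetric] right_diff_distrib)
      moreover have "\<bar>\<Sum>i<k. g (walk (Suc i) \<omega>) * (walk (Suc i) \<omega> / Suc i)\<bar> \<le> B * ?D \<omega>"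
      proof -
        have "\<bar>\<Sum>i<k. g (walk (Suc i) \<omega>) * (walk (Suc i) \<omega> / Suc i)\<bar>
            \<le> (\<Sum>i<k. \<bar>g (walk (Suc i) \<omega>) * (walk (Suc i) \<omega> / Suc i)\<bar>)"
          by (rule sum_abs)
        also have "\<dots> \<le> (\<Sum>i<k. B * (\<bar>walk (Suc i) \<omega>\<bar> / Suc i))"
          by (intro sum_mono) (auto simp: abs_mult simp del: times_divide_eq_right intro!: mult_right_mono g)
        also have "\<dots> \<le> (\<Sum>i<n. B * (\<bar>walk (Suc i) \<omega>\<bar> / Suc i))"
          using k B by (intro sum_mono2) auto
        finally show ?thesis by (simp add: sum_distrib_left)
      qed
      ultimately have "\<bar>?R k \<omega>\<bar> \<ge> 2 * x"
        using k \<open>B * ?D \<omega> < x\<close> by linarith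
      then show "\<exists>k\<le>n. \<bar>?R k \<omega>\<bar> \<ge> 2 * x" using k by blast
    qed
  qed measurable
  also have "\<dots> \<le> prob ?A1 + prob ?A2"
    by (rule measure_Un_le) measurable
  also have "prob ?A1 \<le> 4 * B\<^sup>2 * n * \<tau> / x\<^sup>2"
    by (rule maximal_backward_martingale[OF assms])
  also have "prob ?A2 \<le> 4 * B\<^sup>2 * n * \<tau> / x\<^sup>2"
  proof -
    have "prob ?A2 \<le> expectation (\<lambda>\<omega>. (B * ?D \<omega>)\<^sup>2) / x\<^sup>2"
      using square_integrable_cmult[OF second_moment_drift_le(1)[of n], of B] x
      by (intro second_moment_method) (auto simp: square_integrable_def)
    also have "\<dots> \<le> (B\<^sup>2 * (4 * real n * \<tau>)) / x\<^sup>2"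
      using second_moment_drift_le(2)[of n]
      by (intro divide_right_mono) (auto simp: power_mult_distrib intro!: mult_left_mono)
    finally show ?thesis by (simp add: mult_ac)
  qed
  finally show ?thesis by (simp add: mult_ac)
qed

end

section \<open>Discrete covariations of Hoelder functions\<close>

lemma holder_imp_continuous:
  fixes f :: "real \<Rightarrow> real"
  assumes "\<alpha> > 0" and f: "\<And>x y. \<bar>f x - f y\<bar> \<le> C * \<bar>x - y\<bar> powr \<alpha>"
  shows "continuous_on UNIV f"
proof -
  have "(f \<longlongrightarrow> f x) (at x)" for x
  proof -
    have "((\<lambda>y. \<bar>y - x\<bar>) \<longlongrightarrow> 0) (at x)"
      by (intro tendsto_rabs_zero) (simp add: LIM_zero)
    then have "((\<lambda>y. \<bar>y - x\<bar> powr \<alpha>) \<longlongrightarrow> 0) (at x)"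
      by (rule tendsto_zero_powrI[OF _ tendsto_const]) (use \<open>\<alpha> > 0\<close> in auto)
    then have "((\<lambda>y. C * \<bar>y - x\<bar> powr \<alpha>) \<longlongrightarrow> 0) (at x)"
      by (rule tendsto_mult_right_zero)
    then have "((\<lambda>y. f y - f x) \<longlongrightarrow> 0) (at x)"
      by (rule Lim_null_comparison[rotated]) (simp add: f)
    then show ?thesis
      by (simp add: LIM_zero_iff)
  qed
  then show ?thesis
    by (simp add: continuous_on_eq_continuous_at isCont_def)
qed

text \<open>The approximation is the infimal convolution of f with L |.|, its Lipschitz
  regularisation. The slope L = C h^(\<alpha> - 1) is the one at which the cone L |x - y| and the
  Hoelder bound C |x - y|^\<alpha> meet at distance h.\<close>

lemma holder_imp_lipschitz_approx:
  fixes f :: "real \<Rightarrow> real"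
  assumes \<alpha>: "0 < \<alpha>" "\<alpha> < 1" and C: "C \<ge> 0" and h: "h > 0"
    and f: "\<And>x y. \<bar>f x - f y\<bar> \<le> C * \<bar>x - y\<bar> powr \<alpha>"
  obtains p :: "real \<Rightarrow> real" where
    "\<And>x y. \<bar>p x - p y\<bar> \<le> C * h powr (\<alpha> - 1) * \<bar>x - y\<bar>"
    "\<And>x. \<bar>f x - p x\<bar> \<le> C * h powr \<alpha>"
proof
  define L where "L = C * h powr (\<alpha> - 1)"
  have L: "L \<ge> 0" using C by (simp add: L_def)
  define p where "p = (\<lambda>x. INF y. f y + L * \<bar>x - y\<bar>)"
  \<comment> \<open>Within distance h the Hoelder bound is at most C h^\<alpha>; beyond h it is
    dominated by the cone. This makes the infimum finite and gives the lower half of the estimate of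
    f - p.\<close>
  have low: "f x - C * h powr \<alpha> \<le> f y + L * \<bar>x - y\<bar>" for x y
  proof (cases "\<bar>x - y\<bar> \<le> h")
    case True
    have "\<bar>x - y\<bar> powr \<alpha> \<le> h powr \<alpha>"
      using True \<alpha> by (intro powr_mono2) auto
    then have "C * \<bar>x - y\<bar> powr \<alpha> \<le> C * h powr \<alpha>"
      using C by (rule mult_left_mono)
    moreover have "0 \<le> L * \<bar>x - y\<bar>" using L by simp
    ultimately show ?thesis using f[of x y] by linarith
  next
    case False
    then have pos: "\<bar>x - y\<bar> > 0" using h by linarith
    have "\<bar>x - y\<bar> powr \<alpha> = \<bar>x - y\<bar> powr (\<alpha> - 1) * \<bar>x - y\<bar>"
      using pos powr_mult_base[of "\<bar>x - y\<bar>" "\<alpha> - 1"] by (simp add: mult.commute)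
    also have "\<dots> \<le> h powr (\<alpha> - 1) * \<bar>x - y\<bar>"
      using False \<alpha> h by (intro mult_right_mono powr_mono2') auto
    finally have "C * \<bar>x - y\<bar> powr \<alpha> \<le> L * \<bar>x - y\<bar>"
      unfolding L_def using C by (simp add: mult.assoc mult_left_mono)
    moreover have "0 \<le> C * h powr \<alpha>" using C by simp
    ultimately show ?thesis using f[of x y] by linarith
  qed
  have bdd: "bdd_below (range (\<lambda>y. f y + L * \<bar>x - y\<bar>))" for x
    using low[of x] by (intro bdd_belowI2[where m = "f x - C * h powr \<alpha>"])
  show "\<bar>f x - p x\<bar> \<le> C * h powr \<alpha>" for x
  proof -
    have "p x \<le> f x"
      unfolding p_def using cINF_lower[OF bdd[of x], of x] by simp
    moreover have "f x - C * h powr \<alpha> \<le> p x"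
      unfolding p_def using low by (intro cINF_greatest) auto
    ultimately show ?thesis by linarith
  qed
  \<comment> \<open>An infimum of functions that are Lipschitz with constant \<open>L\<close> is
    Lipschitz with the same constant.\<close>
  have "p x \<le> p y + L * \<bar>x - y\<bar>" for x y
  proof -
    have "p x - L * \<bar>x - y\<bar> \<le> f z + L * \<bar>y - z\<bar>" for z
    proof -
      have "p x \<le> f z + L * \<bar>x - z\<bar>"
        unfolding p_def using bdd[of x] by (intro cINF_lower) auto
      moreover have "L * \<bar>x - z\<bar> \<le> L * (\<bar>x - y\<bar> + \<bar>y - z\<bar>)"
        using L by (intro mult_left_mono) auto
      ultimately show ?thesis by (simp add: distrib_left)
    qed
    then have "p x - L * \<bar>x - y\<bar> \<le> p y"
      unfolding p_def by (intro cINF_greatest) auto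
    then show ?thesis by simp
  qed
  then have "p x \<le> p y + L * \<bar>x - y\<bar>" "p y \<le> p x + L * \<bar>x - y\<bar>" for x y
    using abs_minus_commute[of x y] by metis+
  then show "\<bar>p x - p y\<bar> \<le> C * h powr (\<alpha> - 1) * \<bar>x - y\<bar>" for x y
    unfolding L_def[symmetric] abs_le_iff by (simp add: algebra_simps)
qed

context gaussian_increments begin

text \<open>The hypothesis \<open>hz\<close> makes the Lipschitz part at most z / 2 whenever the
  quadratic variation is below 2 * n * \<tau>. The small part is left to the forward and backward
  maximal inequalities, which do not use its regularity beyond measurability.\<close>

lemma maximal_discrete_covariation:
  assumes \<alpha>: "0 < \<alpha>" "\<alpha> < 1" and C: "C \<ge> 0" and h: "h > 0"
    and f: "\<And>x y. \<bar>f x - f y\<bar> \<le> C * \<bar>x - y\<bar> powr \<alpha>"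
    and \<epsilon>: "\<epsilon> > 0" and z: "z > 0" and n: "n > 0"
    and hz: "2 * C * h powr (\<alpha> - 1) * \<epsilon>\<^sup>2 * (real n * \<tau>) \<le> z / 2"
  shows "prob {\<omega>\<in>space M. \<exists>k\<le>n.
      \<bar>\<Sum>i<k. (f (\<epsilon> * walk (Suc i) \<omega>) - f (\<epsilon> * walk i \<omega>)) * (\<epsilon> * X i \<omega>)\<bar> \<ge> z}
    \<le> 2 / real n + 576 * (C * h powr \<alpha>)\<^sup>2 * (real n * \<tau>) * \<epsilon>\<^sup>2 / z\<^sup>2"
proof -
  obtain p where p: "\<And>x y. \<bar>p x - p y\<bar> \<le> C * h powr (\<alpha> - 1) * \<bar>x - y\<bar>"
    and fp: "\<And>x. \<bar>f x - p x\<bar> \<le> C * h powr \<alpha>"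
    by (rule holder_imp_lipschitz_approx[OF \<alpha> C h f]) blast
  define L where "L = C * h powr (\<alpha> - 1)"
  define B where "B = C * h powr \<alpha>"
  define g where "g = (\<lambda>y. f (\<epsilon> * y) - p (\<epsilon> * y))"
  have L: "L \<ge> 0" using C by (simp add: L_def)
  have [measurable]: "f \<in> borel_measurable borel"
    using holder_imp_continuous[OF \<alpha>(1) f] by (rule borel_measurable_continuous_onI)
  have "continuous_on UNIV p"
    using holder_imp_continuous[of 1 p L] p by (simp add: L_def)
  then have [measurable]: "p \<in> borel_measurable borel"
    by (rule borel_measurable_continuous_onI)
  have gm [measurable]: "g \<in> borel_measurable borel"
    unfolding g_def by measurable
  have g: "\<bar>g y\<bar> \<le> B" for y
    using fp by (simp add: g_def B_def)
  \<comment> \<open>With this threshold the forward sum contributes less than z / 8 and the backward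
    sum less than 3 * z / 8, which together with z / 2 stays below z.\<close>
  define x where "x = z / (8 * \<epsilon>)"
  have x: "x > 0" using z \<epsilon> by (simp add: x_def)
  let ?S = "\<lambda>k \<omega>. \<Sum>i<k. (f (\<epsilon> * walk (Suc i) \<omega>) - f (\<epsilon> * walk i \<omega>)) * (\<epsilon> * X i \<omega>)"
  let ?P = "\<lambda>k \<omega>. \<Sum>i<k. (p (\<epsilon> * walk (Suc i) \<omega>) - p (\<epsilon> * walk i \<omega>)) * (\<epsilon> * X i \<omega>)"
  let ?F = "\<lambda>k \<omega>. \<Sum>i<k. g (walk i \<omega>) * X i \<omega>"
  let ?G = "\<lambda>k \<omega>. \<Sum>i<k. g (walk (Suc i) \<omega>) * X i \<omega>"
  let ?A1 = "{\<omega>\<in>space M. (\<Sum>i<n. (X i \<omega>)\<^sup>2) \<ge> 2 * real n * \<tau>}"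
  let ?A2 = "{\<omega>\<in>space M. \<exists>k\<le>n. \<bar>?F k \<omega>\<bar> \<ge> x}"
  let ?A3 = "{\<omega>\<in>space M. \<exists>k\<le>n. \<bar>?G k \<omega>\<bar> \<ge> 3 * x}"
  \<comment> \<open>The covariation sum of \<open>g\<close> is the backward sum minus the forward
    sum, times \<epsilon>.\<close>
  have dec: "?S k \<omega> = ?P k \<omega> + \<epsilon> * ?G k \<omega> - \<epsilon> * ?F k \<omega>" for k \<omega>
    unfolding sum_distrib_left sum.distrib[symmetric] sum_subtractf[symmetric]
    by (intro sum.cong refl) (simp add: g_def algebra_simps)
  have P: "\<bar>?P k \<omega>\<bar> \<le> L * \<epsilon>\<^sup>2 * (\<Sum>i<n. (X i \<omega>)\<^sup>2)" if "k \<le> n" for k \<omega>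
  proof -
    have "\<bar>?P k \<omega>\<bar> \<le> (\<Sum>i<k. \<bar>(p (\<epsilon> * walk (Suc i) \<omega>) - p (\<epsilon> * walk i \<omega>)) * (\<epsilon> * X i \<omega>)\<bar>)"
      by (rule sum_abs)
    also have "\<dots> \<le> (\<Sum>i<k. L * \<epsilon>\<^sup>2 * (X i \<omega>)\<^sup>2)"
    proof (rule sum_mono)
      fix i
      have "\<bar>p (\<epsilon> * walk (Suc i) \<omega>) - p (\<epsilon> * walk i \<omega>)\<bar> \<le> L * \<bar>\<epsilon> * X i \<omega>\<bar>"
        using p[of "\<epsilon> * walk (Suc i) \<omega>" "\<epsilon> * walk i \<omega>"]
        by (simp add: L_def walk_def algebra_simps)
      then have "\<bar>(p (\<epsilon> * walk (Suc i) \<omega>) - p (\<epsilon> * walk i \<omega>)) * (\<epsilon> * X i \<omega>)\<bar>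
          \<le> L * \<bar>\<epsilon> * X i \<omega>\<bar> * \<bar>\<epsilon> * X i \<omega>\<bar>"
        unfolding abs_mult[of "_ - _"] by (intro mult_right_mono) auto
      also have "\<dots> = L * \<epsilon>\<^sup>2 * (X i \<omega>)\<^sup>2"
        by (simp only: mult.assoc abs_mult_self_eq) (simp add: power2_eq_square mult_ac)
      finally show "\<bar>(p (\<epsilon> * walk (Suc i) \<omega>) - p (\<epsilon> * walk i \<omega>)) * (\<epsilon> * X i \<omega>)\<bar> \<le> L * \<epsilon>\<^sup>2 * (X i \<omega>)\<^sup>2" .
    qed
    also have "\<dots> \<le> (\<Sum>i<n. L * \<epsilon>\<^sup>2 * (X i \<omega>)\<^sup>2)"
      using that L by (intro sum_mono2) auto
    finally show ?thesis by (simp add: sum_distrib_left)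
  qed
  have "prob {\<omega>\<in>space M. \<exists>k\<le>n. \<bar>?S k \<omega>\<bar> \<ge> z} \<le> prob (?A1 \<union> ?A2 \<union> ?A3)"
  proof (rule finite_measure_mono)
    show "{\<omega>\<in>space M. \<exists>k\<le>n. \<bar>?S k \<omega>\<bar> \<ge> z} \<subseteq> ?A1 \<union> ?A2 \<union> ?A3"
    proof (rule subsetI, rule ccontr)
      fix \<omega> assume "\<omega> \<in> {\<omega>\<in>space M. \<exists>k\<le>n. \<bar>?S k \<omega>\<bar> \<ge> z}" and not: "\<omega> \<notin> ?A1 \<union> ?A2 \<union> ?A3"
      then obtain k where \<omega>: "\<omega> \<in> space M" and k: "k \<le> n" "\<bar>?S k \<omega>\<bar> \<ge> z" by auto
      from not \<omega> have A1: "(\<Sum>i<n. (X i \<omega>)\<^sup>2) < 2 * real n * \<tau>"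
        and A2: "\<bar>?F k \<omega>\<bar> < x" and A3: "\<bar>?G k \<omega>\<bar> < 3 * x"
        using k(1) by (simp_all add: not_le) (meson not_le)+
      have "L * \<epsilon>\<^sup>2 * (\<Sum>i<n. (X i \<omega>)\<^sup>2) \<le> L * \<epsilon>\<^sup>2 * (2 * real n * \<tau>)"
        using L A1 by (intro mult_left_mono) auto
      also have "\<dots> \<le> z / 2"
        using hz by (simp add: L_def mult_ac)
      finally have "\<bar>?P k \<omega>\<bar> \<le> z / 2"
        using P[OF k(1), of \<omega>] by linarith
      moreover have "\<bar>\<epsilon> * ?F k \<omega>\<bar> < z / 8"
        using A2 \<epsilon> by (simp add: abs_mult x_def field_simps)
      moreover have "\<bar>\<epsilon> * ?G k \<omega>\<bar> < 3 * z / 8"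
        using A3 \<epsilon> by (simp add: abs_mult x_def field_simps)
      ultimately show False
        using k(2) unfolding dec by linarith
    qed
  qed measurable
  also have "\<dots> \<le> prob ?A1 + prob ?A2 + prob ?A3"
  proof -
    have "prob (?A1 \<union> ?A2 \<union> ?A3) \<le> prob (?A1 \<union> ?A2) + prob ?A3"
      by (rule measure_Un_le) measurable
    moreover have "prob (?A1 \<union> ?A2) \<le> prob ?A1 + prob ?A2"
      by (rule measure_Un_le) measurable
    ultimately show ?thesis by linarith
  qed
  also have "\<dots> \<le> 2 / real n + B\<^sup>2 * real n * \<tau> / x\<^sup>2 + 8 * B\<^sup>2 * real n * \<tau> / x\<^sup>2"
    by (intro add_mono prob_quadratic_variation_le[OF n] maximal_forward[OF gm g x] maximal_backward[OF gm g x])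
  \<comment> \<open>The forward and backward bounds add up to 9 * B^2 * n * \<tau> / x^2, and 9 * 64
    = 576.\<close>
  also have "\<dots> = 2 / real n + 576 * B\<^sup>2 * (real n * \<tau>) * \<epsilon>\<^sup>2 / z\<^sup>2"
  proof -
    have "1 / x\<^sup>2 = 64 * \<epsilon>\<^sup>2 / z\<^sup>2"
      by (simp add: x_def power_divide power_mult_distrib)
    then have "a / x\<^sup>2 = 64 * a * \<epsilon>\<^sup>2 / z\<^sup>2" for a
      by (metis (no_types) divide_inverse inverse_eq_divide mult.assoc mult.commute)
    then show ?thesis by (simp add: mult_ac)
  qed
  finally show ?thesis unfolding B_def .
qed

end

section \<open>Brownian increments over a uniform grid\<close>

lemma brownian_motion_gaussian_increments:
  assumes BM: "brownian_motion M W" and \<tau>: "\<tau> > 0"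
  shows "gaussian_increments M (\<lambda>k \<omega>. W (real (Suc k) * \<tau>) \<omega> - W (real k * \<tau>) \<omega>) \<tau>"
proof -
  interpret prob_space M
    using BM by (simp add: brownian_motion_def)
  let ?X = "\<lambda>k \<omega>. W (real (Suc k) * \<tau>) \<omega> - W (real k * \<tau>) \<omega>"
  have lt: "real k * \<tau> < real (Suc k) * \<tau>" for k
    using \<tau> by (intro mult_strict_right_mono) auto
  show ?thesis
  proof
    show "\<tau> > 0" by (rule \<tau>)
    show "distributed M lborel (?X i) (normal_density 0 (sqrt \<tau>))" for i
    proof -
      have "distributed M lborel (?X i) (normal_density 0 (sqrt (real (Suc i) * \<tau> - real i * \<tau>)))"
        using BM lt[of i] \<tau> unfolding brownian_motion_def by simp
      moreover have "real (Suc i) * \<tau> - real i * \<tau> = \<tau>"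
        by (simp add: algebra_simps)
      ultimately show ?thesis by simp
    qed
    have fin: "indep_vars (\<lambda>_. borel) ?X {..<n}" for n
    proof -
      have "\<forall>(u::nat \<Rightarrow> real) n. 0 \<le> u 0 \<and> (\<forall>k<n. u k < u (Suc k)) \<longrightarrow>
          indep_vars (\<lambda>_. borel) (\<lambda>k \<omega>. W (u (Suc k)) \<omega> - W (u k) \<omega>) {..<n}"
        using BM unfolding brownian_motion_def by (elim conjE)
      from this[rule_format, of "\<lambda>k. real k * \<tau>" n] show ?thesis
        using lt by simp
    qed
    show "indep_vars (\<lambda>_. borel) ?X UNIV"
      unfolding indep_vars_def2
    proof
      show "\<forall>i\<in>UNIV. random_variable borel (?X i)"
      proof
        fix i
        have "i \<in> {..<Suc i}" by simp
        then show "random_variable borel (?X i)"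
          using fin[of "Suc i"] unfolding indep_vars_def2 by (elim conjE) (rule bspec)
      qed
      \<comment> \<open>Independence of an infinite family is a property of its finite subfamilies,
        each contained in an initial block of increments.\<close>
      show "indep_sets (\<lambda>i. {?X i -` A \<inter> space M |A. A \<in> sets borel}) UNIV"
      proof (subst indep_sets_finite_index_sets, intro allI impI)
        fix J :: "nat set" assume "finite J"
        then obtain n where "J \<subseteq> {..<n}"
          using finite_nat_iff_bounded by blast
        then show "indep_sets (\<lambda>i. {?X i -` A \<inter> space M |A. A \<in> sets borel}) J"
          using fin[of n] unfolding indep_vars_def2 by (blast intro: indep_sets_mono_index)
      qed
    qed
  qed
qed

section \<open>Passage to the quadratic covariation\<close>

lemma is_partition_uniform:
  assumes "\<tau> > 0"
  shows "is_partition (\<lambda>k. real k * \<tau>) m (real m * \<tau>)"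
  using assms by (auto simp: is_partition_def)

lemma mesh_uniform_le:
  assumes "\<tau> > 0"
  shows "mesh (\<lambda>k. real k * \<tau>) m \<le> \<tau>"
  using assms by (auto simp: mesh_def algebra_simps)

text \<open>The grid is refined until the covariation sums are within z / 2 of Q at all its points,
  with high probability. The remaining z / 2 goes to the discrete maximal bound, whence 2304 = 4 *
  576 and the z / 4 in \<open>hz\<close>.\<close>

lemma prob_grid_covariation_le:
  assumes BM: "brownian_motion M W" and T: "T > 0"
    and \<alpha>: "0 < \<alpha>" "\<alpha> < 1" and C: "C \<ge> 0" and h: "h > 0"
    and f: "\<And>x y. \<bar>f x - f y\<bar> \<le> C * \<bar>x - y\<bar> powr \<alpha>"
    and \<epsilon>: "\<epsilon> > 0" and z: "z > 0"
    and hz: "2 * C * h powr (\<alpha> - 1) * \<epsilon>\<^sup>2 * T \<le> z / 4"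
    and Qm: "\<And>t. Q t \<in> borel_measurable M"
    and Q: "is_quadratic_covariation M (\<lambda>t \<omega>. f (\<epsilon> * W t \<omega>)) (\<lambda>t \<omega>. \<epsilon> * W t \<omega>) Q T"
    and N: "N > (0::nat)"
  shows "measure M {\<omega>\<in>space M. \<exists>j\<le>N. \<bar>Q (real j * (T / N)) \<omega>\<bar> > z}
    \<le> 2304 * (C * h powr \<alpha>)\<^sup>2 * T * \<epsilon>\<^sup>2 / z\<^sup>2"
proof (rule field_le_epsilon)
  \<comment> \<open>The slack \<open>e\<close> absorbs the term 2 / n and the errors of convergence
    in probability, half of it for each.\<close>
  fix e :: real assume e: "e > 0"
  interpret prob_space M
    using BM by (simp add: brownian_motion_def)
  note [measurable] = Qm
  have Wm [measurable]: "W t \<in> borel_measurable M" if "t \<ge> 0" for t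
    using BM that by (simp add: brownian_motion_def)
  have [measurable]: "f \<in> borel_measurable borel"
    using holder_imp_continuous[OF \<alpha>(1) f] by (rule borel_measurable_continuous_onI)
  define S where "S = (\<lambda>u m \<omega>. \<Sum>k<m. (f (\<epsilon> * W (u (Suc k)) \<omega>) - f (\<epsilon> * W (u k) \<omega>)) *
      (\<epsilon> * W (u (Suc k)) \<omega> - \<epsilon> * W (u k) \<omega>))"
  define t where "t = (\<lambda>j::nat. real j * (T / N))"
  have t: "t j \<in> {0..T}" if "j \<le> N" for j
  proof -
    have "real j * T \<le> T * real N"
      using that T by (simp add: mult.commute)
    then show ?thesis using T N by (simp add: t_def divide_le_eq)
  qed
  \<comment> \<open>There are N + 1 grid points, so their errors add up to e / 2.\<close>
  define e' where "e' = e / (2 * Suc N)"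
  have e': "e' > 0" using e by (simp add: e'_def)
  have "\<exists>d>0. \<forall>u m. is_partition u m (t j) \<and> mesh u m < d \<longrightarrow>
      prob {\<omega>\<in>space M. \<bar>S u m \<omega> - Q (t j) \<omega>\<bar> > z / 2} < e'" if "j \<le> N" for j
    using Q t[OF that] z e' unfolding is_quadratic_covariation_def S_def by (meson half_gt_zero)
  then obtain d where d: "\<And>j. j \<le> N \<Longrightarrow> d j > 0"
    and dS: "\<And>j u m. j \<le> N \<Longrightarrow> is_partition u m (t j) \<Longrightarrow> mesh u m < d j \<Longrightarrow>
      prob {\<omega>\<in>space M. \<bar>S u m \<omega> - Q (t j) \<omega>\<bar> > z / 2} < e'"
    by metis
  define d' where "d' = Min (d ` {..N})"
  have d': "d' > 0" "\<And>j. j \<le> N \<Longrightarrow> d' \<le> d j"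
    using d by (auto simp: d'_def)
  \<comment> \<open>The first bound makes the step of the refined grid smaller than every required
    mesh, the second makes 2 / n less than e / 2.\<close>
  obtain r :: nat where r: "r > max (T / d') (4 / e)"
    using reals_Archimedean2 by blast
  have r0: "r > 0"
    using r e by (metis (no_types) divide_pos_pos max_less_iff_conj of_nat_0_less_iff order_less_trans zero_less_numeral)
  \<comment> \<open>A multiple of \<open>N\<close>, so that each grid point \<open>t j\<close> is
    the point of index \<open>j * r\<close> of the refined grid, and one walk serves all
    \<open>j\<close>.\<close>
  define n where "n = N * r"
  define \<tau> where "\<tau> = T / n"
  have n: "n > 0" using N r0 by (simp add: n_def)
  have \<tau>: "\<tau> > 0" using T n by (simp add: \<tau>_def)
  have n\<tau>: "real n * \<tau> = T" using n by (simp add: \<tau>_def)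
  have rn: "real r \<le> real n"
    unfolding n_def of_nat_le_iff using N by simp
  have \<tau>d: "\<tau> < d'"
  proof -
    have "T / d' < real n" using r rn by simp
    then show ?thesis using d' n by (simp add: \<tau>_def field_simps)
  qed
  have ne: "2 / real n < e / 2"
  proof -
    have "4 / e < real n" using r rn by simp
    then show ?thesis using e n by (simp add: field_simps)
  qed
  define X where "X = (\<lambda>k \<omega>. W (real (Suc k) * \<tau>) \<omega> - W (real k * \<tau>) \<omega>)"
  interpret gaussian_increments M X \<tau>
    unfolding X_def by (rule brownian_motion_gaussian_increments[OF BM \<tau>])
  have walk: "walk k \<omega> = W (real k * \<tau>) \<omega>" if "\<omega> \<in> space M" for k \<omega>
  proof -
    have "W 0 \<omega> = 0" using BM that by (simp add: brownian_motion_def)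
    then have "(\<Sum>i<k. X i \<omega>) = W (real k * \<tau>) \<omega>"
      unfolding X_def using sum_lessThan_telescope[of "\<lambda>k. W (real k * \<tau>) \<omega>" k] by simp
    then show ?thesis by (simp add: walk_def)
  qed
  define u where "u = (\<lambda>k. real k * \<tau>)"
  have u0: "u k \<ge> 0" for k using \<tau> by (simp add: u_def)
  have [measurable]: "S u m \<in> borel_measurable M" for m
    unfolding S_def using u0 by measurable
  have SX: "S u k \<omega> = (\<Sum>i<k. (f (\<epsilon> * walk (Suc i) \<omega>) - f (\<epsilon> * walk i \<omega>)) * (\<epsilon> * X i \<omega>))"
    if "\<omega> \<in> space M" for k \<omega>
    unfolding S_def u_def walk[OF that] unfolding X_def right_diff_distrib ..
  let ?A = "{\<omega>\<in>space M. \<exists>k\<le>n. \<bar>S u k \<omega>\<bar> \<ge> z / 2}"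
  let ?B = "\<lambda>j. {\<omega>\<in>space M. \<bar>S u (j * r) \<omega> - Q (t j) \<omega>\<bar> > z / 2}"
  let ?E = "{\<omega>\<in>space M. \<exists>j\<le>N. \<bar>Q (t j) \<omega>\<bar> > z}"
  have A: "prob ?A \<le> 2 / real n + 2304 * (C * h powr \<alpha>)\<^sup>2 * T * \<epsilon>\<^sup>2 / z\<^sup>2"
  proof -
    have "?A = {\<omega>\<in>space M. \<exists>k\<le>n.
      \<bar>\<Sum>i<k. (f (\<epsilon> * walk (Suc i) \<omega>) - f (\<epsilon> * walk i \<omega>)) * (\<epsilon> * X i \<omega>)\<bar> \<ge> z / 2}"
      using SX by auto
    then have "prob ?A \<le> 2 / real n + 576 * (C * h powr \<alpha>)\<^sup>2 * (real n * \<tau>) * \<epsilon>\<^sup>2 / (z / 2)\<^sup>2"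
      using maximal_discrete_covariation[OF \<alpha> C h f \<epsilon> _ n, of "z / 2"] z hz by (simp add: n\<tau>)
    then show ?thesis by (simp add: n\<tau> power_divide)
  qed
  have B: "prob (?B j) < e'" if "j \<le> N" for j
  proof (rule dS[OF that])
    have "t j = real (j * r) * \<tau>"
      using r0 by (simp add: t_def \<tau>_def n_def)
    then show "is_partition u (j * r) (t j)"
      unfolding u_def by (simp only: is_partition_uniform[OF \<tau>])
    show "mesh u (j * r) < d j"
      using mesh_uniform_le[OF \<tau>, of "j * r"] \<tau>d d'(2)[OF that] by (simp add: u_def)
  qed
  have "prob ?E \<le> prob (?A \<union> (\<Union>j\<in>{..N}. ?B j))"
  proof (rule finite_measure_mono)
    show "?E \<subseteq> ?A \<union> (\<Union>j\<in>{..N}. ?B j)"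
    proof safe
      fix \<omega> j assume \<omega>: "\<omega> \<in> space M" and j: "j \<le> N" "z < \<bar>Q (t j) \<omega>\<bar>" and "\<omega> \<notin> (\<Union>j\<in>{..N}. ?B j)"
      then have "\<bar>S u (j * r) \<omega> - Q (t j) \<omega>\<bar> \<le> z / 2" by (auto simp: not_less)
      then have "\<bar>S u (j * r) \<omega>\<bar> \<ge> z / 2" using j(2) by linarith
      moreover have "j * r \<le> n" using j by (simp add: n_def)
      ultimately show "\<exists>k\<le>n. z / 2 \<le> \<bar>S u k \<omega>\<bar>" by blast
    qed
  qed measurable
  also have "\<dots> \<le> prob ?A + prob (\<Union>j\<in>{..N}. ?B j)"
    by (rule measure_Un_le) measurable
  also have "prob (\<Union>j\<in>{..N}. ?B j) \<le> (\<Sum>j\<in>{..N}. prob (?B j))"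
    by (rule measure_UNION_le) auto
  also have "\<dots> \<le> (\<Sum>j\<in>{..N}. e')"
    using B by (intro sum_mono) (auto intro: less_imp_le)
  also have "\<dots> = e / 2"
    by (simp add: e'_def field_simps)
  finally show "prob {\<omega>\<in>space M. \<exists>j\<le>N. \<bar>Q (real j * (T / N)) \<omega>\<bar> > z}
      \<le> 2304 * (C * h powr \<alpha>)\<^sup>2 * T * \<epsilon>\<^sup>2 / z\<^sup>2 + e"
    using A ne unfolding t_def by linarith
qed

text \<open>Dyadic grids are nested, so the events \<open>E\<close> increase. By continuity of the
  paths their union covers the event for the supremum, and continuity of the measure from below
  carries the uniform bound over.\<close>

lemma prob_SUP_le_of_grid:
  fixes Q :: "real \<Rightarrow> 'a \<Rightarrow> real"
  assumes "finite_measure M" and T: "T > 0" and [measurable]: "\<And>t. Q t \<in> borel_measurable M"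
    and cont: "\<And>\<omega>. \<omega> \<in> space M \<Longrightarrow> continuous_on {0..T} (\<lambda>t. Q t \<omega>)"
    and grid: "\<And>N::nat. N > 0 \<Longrightarrow> measure M {\<omega>\<in>space M. \<exists>j\<le>N. \<bar>Q (real j * (T / N)) \<omega>\<bar> > z} \<le> p"
  shows "measure M {\<omega>\<in>space M. (SUP t\<in>{0..T}. \<bar>Q t \<omega>\<bar>) > z} \<le> p"
proof -
  interpret finite_measure M by fact
  define E where "E = (\<lambda>n::nat. {\<omega>\<in>space M. \<exists>j\<le>2 ^ n. \<bar>Q (real j * (T / real (2 ^ n))) \<omega>\<bar> > z})"
  have [measurable]: "E n \<in> sets M" for n
    unfolding E_def by measurable
  have "E n \<subseteq> E (Suc n)" for n
  proof
    fix \<omega> assume "\<omega> \<in> E n"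
    then obtain j where "\<omega> \<in> space M" "j \<le> 2 ^ n" "\<bar>Q (real j * (T / real (2 ^ n))) \<omega>\<bar> > z"
      by (auto simp: E_def)
    moreover have "real (2 * j) * (T / real (2 ^ Suc n)) = real j * (T / real (2 ^ n))"
      by simp
    moreover have "2 * j \<le> 2 ^ Suc n" using \<open>j \<le> 2 ^ n\<close> by simp
    ultimately show "\<omega> \<in> E (Suc n)"
      unfolding E_def by (smt (verit) mem_Collect_eq)
  qed
  then have "incseq E" by (rule incseq_SucI)
  have sub: "{\<omega>\<in>space M. (SUP t\<in>{0..T}. \<bar>Q t \<omega>\<bar>) > z} \<subseteq> (\<Union>n. E n)"
  proof safe
    fix \<omega> assume \<omega>: "\<omega> \<in> space M" and sup: "(SUP t\<in>{0..T}. \<bar>Q t \<omega>\<bar>) > z"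
    have "compact ((\<lambda>t. \<bar>Q t \<omega>\<bar>) ` {0..T})"
      by (intro compact_continuous_image continuous_on_rabs cont[OF \<omega>]) auto
    then have "bdd_above ((\<lambda>t. \<bar>Q t \<omega>\<bar>) ` {0..T})"
      by (intro bounded_imp_bdd_above compact_imp_bounded)
    with sup T obtain t where t: "t \<in> {0..T}" "\<bar>Q t \<omega>\<bar> > z"
      by (subst (asm) less_cSUP_iff) auto
    then obtain d where d: "d > 0"
      "\<And>s. s \<in> {0..T} \<Longrightarrow> dist s t < d \<Longrightarrow> dist (Q s \<omega>) (Q t \<omega>) < \<bar>Q t \<omega>\<bar> - z"
      using cont[OF \<omega>] unfolding continuous_on_iff by (meson diff_gt_0_iff_gt)
    obtain n :: nat where "(1/2) ^ n < d / T"
      using real_arch_pow_inv[of "d / T" "1/2"] d(1) T by auto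
    then have n: "T / 2 ^ n < d"
      using T by (simp add: power_divide field_simps)
    \<comment> \<open>Rounding \<open>t\<close> down to the dyadic grid gives a point
      \<open>s\<close> with t - s < T / 2^n < d, at which |Q| still exceeds
      \<open>z\<close>.\<close>
    define j where "j = nat \<lfloor>t * 2 ^ n / T\<rfloor>"
    define s where "s = real j * (T / 2 ^ n)"
    have jf: "real j = of_int \<lfloor>t * 2 ^ n / T\<rfloor>"
      using t T by (simp add: j_def)
    have j: "real j \<le> t * 2 ^ n / T" "t * 2 ^ n / T < real j + 1"
      unfolding jf by linarith+
    have s: "s \<le> t" "t < s + T / 2 ^ n"
      using j T by (simp_all add: s_def field_simps)
    have "real j \<le> 2 ^ n"
    proof -
      have "t * 2 ^ n / T \<le> 2 ^ n" using t T by (simp add: field_simps)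
      then show ?thesis using j(1) by linarith
    qed
    then have jn: "j \<le> 2 ^ n"
      by (metis of_nat_le_iff of_nat_numeral of_nat_power)
    have "dist (Q s \<omega>) (Q t \<omega>) < \<bar>Q t \<omega>\<bar> - z"
      using s n t T by (intro d(2)) (auto simp: dist_real_def s_def)
    then have "\<bar>Q s \<omega>\<bar> > z"
      unfolding dist_real_def by linarith
    then have "\<omega> \<in> E n"
      using \<omega> jn by (auto simp: E_def s_def)
    then show "\<omega> \<in> (\<Union>n. E n)" by blast
  qed
  have "measure M {\<omega>\<in>space M. (SUP t\<in>{0..T}. \<bar>Q t \<omega>\<bar>) > z} \<le> measure M (\<Union>n. E n)"
    by (intro finite_measure_mono sub) measurable
  also have "\<dots> \<le> p"
  proof (rule LIMSEQ_le_const2)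
    show "(\<lambda>n. measure M (E n)) \<longlonglongrightarrow> measure M (\<Union>n. E n)"
      by (intro finite_Lim_measure_incseq \<open>incseq E\<close>) auto
    show "\<exists>N. \<forall>n\<ge>N. measure M (E n) \<le> p"
      unfolding E_def by (intro exI allI impI grid) simp
  qed
  finally show ?thesis .
qed

text \<open>Small distances are controlled by the modulus of continuity, distances of at least
  \<delta> / 2 by the boundedness of f. The result is a Hoelder bound on the whole line.\<close>

lemma bounded_osc_imp_holder:
  fixes f :: "real \<Rightarrow> real"
  assumes f_bdd: "bounded (range f)" and \<alpha>: "\<alpha> > 0" and \<delta>: "\<delta> > 0"
    and osc: "\<And>d. 0 < d \<Longrightarrow> d < \<delta> \<Longrightarrow> osc f d \<le> c * d powr \<alpha>"
  obtains C where "C > 0" "\<And>x y. \<bar>f x - f y\<bar> \<le> C * \<bar>x - y\<bar> powr \<alpha>"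
proof -
  obtain b where b: "\<And>x. \<bar>f x\<bar> \<le> b"
    using f_bdd by (auto simp: bounded_iff)
  \<comment> \<open>One entry for each range of distances; the summand 1 makes the constant
    positive.\<close>
  define C where "C = max (\<bar>c\<bar> * 2 powr \<alpha>) (2 * b / (\<delta> / 2) powr \<alpha>) + 1"
  have C: "\<bar>c\<bar> * 2 powr \<alpha> \<le> C" "2 * b / (\<delta> / 2) powr \<alpha> \<le> C"
    by (auto simp: C_def)
  have Cpos: "C > 0" using C(1) by (smt (verit) C_def mult_nonneg_nonneg powr_ge_zero)
  \<comment> \<open>A real \<open>Sup\<close> dominates the elements of a set only if the set is
    bounded above; boundedness of f supplies this.\<close>
  have bdd: "bdd_above {\<bar>f s - f t\<bar> | s t. \<bar>t - s\<bar> < d}" for d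
  proof (rule bdd_aboveI)
    fix v assume "v \<in> {\<bar>f s - f t\<bar> | s t. \<bar>t - s\<bar> < d}"
    then obtain s t where "v = \<bar>f s - f t\<bar>" by auto
    then show "v \<le> 2 * b" using b[of s] b[of t] by linarith
  qed
  have "\<bar>f x - f y\<bar> \<le> C * \<bar>x - y\<bar> powr \<alpha>" for x y
  proof -
    consider "x = y" | "x \<noteq> y" "2 * \<bar>x - y\<bar> < \<delta>" | "2 * \<bar>x - y\<bar> \<ge> \<delta>" by linarith
    then show ?thesis
    proof cases
      case 2
      \<comment> \<open>The supremum in \<open>osc\<close> runs over distances strictly below its
        argument, so the modulus is taken at twice the distance; hence the factor
        2^\<alpha>.\<close>
      have "\<bar>f x - f y\<bar> \<le> osc f (2 * \<bar>x - y\<bar>)"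
      proof -
        have "\<bar>y - x\<bar> < 2 * \<bar>x - y\<bar>" using 2 by (auto simp: abs_real_def)
        then show ?thesis
          unfolding osc_def by (intro cSup_upper bdd) blast
      qed
      also have "\<dots> \<le> c * (2 * \<bar>x - y\<bar>) powr \<alpha>"
        using 2 by (intro osc) auto
      also have "\<dots> = c * 2 powr \<alpha> * \<bar>x - y\<bar> powr \<alpha>"
        by (simp add: powr_mult)
      also have "\<dots> \<le> C * \<bar>x - y\<bar> powr \<alpha>"
        using C(1) by (intro mult_right_mono) (smt (verit) mult_right_mono powr_ge_zero, simp)
      finally show ?thesis .
    next
      case 3
      have "(\<delta> / 2) powr \<alpha> \<le> \<bar>x - y\<bar> powr \<alpha>"
        using 3 \<alpha> \<delta> by (intro powr_mono2) auto
      then have "2 * b / (\<delta> / 2) powr \<alpha> * (\<delta> / 2) powr \<alpha> \<le> C * \<bar>x - y\<bar> powr \<alpha>"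
        using C Cpos by (intro mult_mono) auto
      then have "2 * b \<le> C * \<bar>x - y\<bar> powr \<alpha>"
        using \<delta> by simp
      then show ?thesis using b[of x] b[of y] by linarith
    qed simp
  qed
  then show ?thesis using Cpos by (rule that[rotated])
qed

section \<open>Choice of the splitting scale and the rate\<close>

theorem theorem1:
  fixes M :: "'a measure" and W :: "real \<Rightarrow> 'a \<Rightarrow> real" and f :: "real \<Rightarrow> real"
    and T \<alpha> C\<^sub>f :: real and Q :: "real \<Rightarrow> real \<Rightarrow> 'a \<Rightarrow> real"
  assumes BM: "brownian_motion M W"
    and T: "T > 0"
    and f_bdd: "bounded (range f)"
    and \<alpha>: "0 < \<alpha>" "\<alpha> < 1"
    and Cf: "C\<^sub>f > 0"
    and osc: "\<exists>\<delta>\<^sub>0>0. \<forall>\<delta>. 0 < \<delta> \<and> \<delta> < \<delta>\<^sub>0 \<longrightarrow> osc f \<delta> \<le> C\<^sub>f * \<delta> powr \<alpha>"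
    and Q: "\<And>\<epsilon>. \<epsilon> > 0 \<Longrightarrow>
              (\<forall>t. Q \<epsilon> t \<in> borel_measurable M) \<and>
              (\<forall>\<omega>\<in>space M. continuous_on {0..T} (\<lambda>t. Q \<epsilon> t \<omega>)) \<and>
              is_quadratic_covariation M (\<lambda>t \<omega>. f (\<epsilon> * W t \<omega>)) (\<lambda>t \<omega>. \<epsilon> * W t \<omega>) (Q \<epsilon>) T"
  shows "(\<forall>\<delta>>0. \<forall>\<gamma> \<mu>. 0 < \<gamma> \<and> \<gamma> < \<alpha> \<and> \<gamma> < \<mu> \<and> \<mu> < \<alpha> \<longrightarrow>
            (\<exists>\<epsilon>\<^sub>0>0. \<exists>C>0. \<forall>\<epsilon>. 0 < \<epsilon> \<and> \<epsilon> < \<epsilon>\<^sub>0 \<longrightarrow>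
               measure M {\<omega>\<in>space M. \<epsilon> powr (-(1 + \<gamma>)) * (SUP t\<in>{0..T}. \<bar>Q \<epsilon> t \<omega>\<bar>) > \<delta>}
                 \<le> C * \<epsilon> powr (2 * (\<alpha> - \<mu>) / (1 - \<alpha>))))
       \<and> (\<forall>\<gamma>. 0 < \<gamma> \<and> \<gamma> < \<alpha> \<longrightarrow> (\<forall>\<delta>>0.
            ((\<lambda>\<epsilon>. measure M {\<omega>\<in>space M. \<epsilon> powr (-(1 + \<gamma>)) * (SUP t\<in>{0..T}. \<bar>Q \<epsilon> t \<omega>\<bar>) > \<delta>})
              \<longlongrightarrow> 0) (at_right 0)))"
proof (intro conjI allI impI)
  obtain \<delta>\<^sub>0 where \<delta>\<^sub>0: "\<delta>\<^sub>0 > 0" "\<And>\<delta>. 0 < \<delta> \<Longrightarrow> \<delta> < \<delta>\<^sub>0 \<Longrightarrow> osc f \<delta> \<le> C\<^sub>f * \<delta> powr \<alpha>"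
    using osc by blast
  obtain C where C: "C > 0" and f: "\<And>x y. \<bar>f x - f y\<bar> \<le> C * \<bar>x - y\<bar> powr \<alpha>"
    using bounded_osc_imp_holder[OF f_bdd \<alpha>(1) \<delta>\<^sub>0] by blast
  interpret prob_space M
    using BM by (simp add: brownian_motion_def)
  let ?P = "\<lambda>\<gamma> \<delta> \<epsilon>. prob {\<omega>\<in>space M. \<epsilon> powr (-(1 + \<gamma>)) * (SUP t\<in>{0..T}. \<bar>Q \<epsilon> t \<omega>\<bar>) > \<delta>}"
  \<comment> \<open>The exponent here has \<gamma> in place of \<mu>; both claims follow from this
    bound.\<close>
  have rate: "\<exists>c>0. \<forall>\<epsilon>. 0 < \<epsilon> \<and> \<epsilon> < 1 \<longrightarrow> ?P \<gamma> \<delta> \<epsilon> \<le> c * \<epsilon> powr (2 * (\<alpha> - \<gamma>) / (1 - \<alpha>))"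
    if \<delta>: "\<delta> > 0" for \<gamma> \<delta>
  proof -
    \<comment> \<open>Chosen so that with h = K \<epsilon>^((1 - \<gamma>) / (1 - \<alpha>)) the
      condition on the Lipschitz part, 2 C h^(\<alpha> - 1) \<epsilon>^2 T <= z / 4, holds with
      equality.\<close>
    define K where "K = (8 * C * T / \<delta>) powr (1 / (1 - \<alpha>))"
    have K: "K > 0" using C T \<delta> by (simp add: K_def)
    have "K powr (\<alpha> - 1) = (8 * C * T / \<delta>) powr (- 1)"
      unfolding K_def powr_powr using \<alpha> by (intro arg_cong2[where f = "(powr)"] refl) (simp add: field_simps)
    then have K1: "K powr (\<alpha> - 1) = \<delta> / (8 * C * T)"
      using C T \<delta> by (simp add: powr_minus_divide)
    define c where "c = 2304 * (C * K powr \<alpha>)\<^sup>2 * T / \<delta>\<^sup>2"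
    have "?P \<gamma> \<delta> \<epsilon> \<le> c * \<epsilon> powr (2 * (\<alpha> - \<gamma>) / (1 - \<alpha>))" if \<epsilon>: "0 < \<epsilon>" for \<epsilon>
    proof -
      define z where "z = \<delta> * \<epsilon> powr (1 + \<gamma>)"
      define h where "h = K * \<epsilon> powr ((1 - \<gamma>) / (1 - \<alpha>))"
      have z: "z > 0" and h: "h > 0"
        using \<delta> \<epsilon> K by (simp_all add: z_def h_def)
      have \<epsilon>2: "\<epsilon>\<^sup>2 = \<epsilon> powr 2" using \<epsilon> by simp
      have "h powr (\<alpha> - 1) = K powr (\<alpha> - 1) * \<epsilon> powr ((1 - \<gamma>) / (1 - \<alpha>) * (\<alpha> - 1))"
        by (simp add: h_def powr_mult powr_powr)
      also have "(1 - \<gamma>) / (1 - \<alpha>) * (\<alpha> - 1) = \<gamma> - 1"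
        using \<alpha> by (simp add: field_simps)
      finally have h1: "h powr (\<alpha> - 1) = \<delta> / (8 * C * T) * \<epsilon> powr (\<gamma> - 1)"
        unfolding K1 .
      have "2 * C * h powr (\<alpha> - 1) * \<epsilon>\<^sup>2 * T = \<delta> / 4 * (\<epsilon> powr (\<gamma> - 1) * \<epsilon> powr 2)"
        using C T unfolding h1 \<epsilon>2 by (simp add: field_simps)
      also have "\<epsilon> powr (\<gamma> - 1) * \<epsilon> powr 2 = \<epsilon> powr (1 + \<gamma>)"
        by (simp add: powr_add[symmetric])
      finally have hz: "2 * C * h powr (\<alpha> - 1) * \<epsilon>\<^sup>2 * T \<le> z / 4"
        by (simp add: z_def)
      have "?P \<gamma> \<delta> \<epsilon> = prob {\<omega>\<in>space M. (SUP t\<in>{0..T}. \<bar>Q \<epsilon> t \<omega>\<bar>) > z}"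
        using \<epsilon> unfolding powr_minus_divide
        by (intro arg_cong[where f = prob] Collect_cong) (simp add: z_def less_divide_eq)
      also have "\<dots> \<le> 2304 * (C * h powr \<alpha>)\<^sup>2 * T * \<epsilon>\<^sup>2 / z\<^sup>2"
        using Q[OF \<epsilon>] C
        by (intro prob_SUP_le_of_grid prob_grid_covariation_le[OF BM T \<alpha> _ h f \<epsilon> z hz])
           (auto intro: T finite_measure_axioms)
      also have "\<dots> = c * \<epsilon> powr (2 * (\<alpha> - \<gamma>) / (1 - \<alpha>))"
      proof -
        \<comment> \<open>\<open>?a\<close> is the exponent from h^(2\<alpha>) and \<open>?b\<close>
          = -2\<gamma> the one from \<epsilon>^2 / z^2; they add up to 2(\<alpha> - \<gamma>) / (1 -
          \<alpha>).\<close>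
        let ?a = "2 * ((1 - \<gamma>) / (1 - \<alpha>) * \<alpha>)" and ?b = "2 - 2 * (1 + \<gamma>)"
        have hC: "(C * h powr \<alpha>)\<^sup>2 = (C * K powr \<alpha>)\<^sup>2 * \<epsilon> powr ?a"
          using \<epsilon> by (simp add: h_def powr_mult powr_powr power_mult_distrib powr_power)
        have z2: "z\<^sup>2 = \<delta>\<^sup>2 * \<epsilon> powr (2 * (1 + \<gamma>))"
          using \<epsilon> by (simp add: z_def power_mult_distrib powr_power)
        have \<epsilon>z: "\<epsilon>\<^sup>2 / z\<^sup>2 = \<epsilon> powr ?b / \<delta>\<^sup>2"
          unfolding z2 \<epsilon>2 powr_diff by simp
        have "2304 * (C * h powr \<alpha>)\<^sup>2 * T * \<epsilon>\<^sup>2 / z\<^sup>2 = 2304 * (C * h powr \<alpha>)\<^sup>2 * T * (\<epsilon>\<^sup>2 / z\<^sup>2)"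
          by simp
        also have "\<dots> = c * (\<epsilon> powr ?a * \<epsilon> powr ?b)"
          unfolding hC \<epsilon>z c_def by simp
        also have "\<epsilon> powr ?a * \<epsilon> powr ?b = \<epsilon> powr (2 * (\<alpha> - \<gamma>) / (1 - \<alpha>))"
          unfolding powr_add[symmetric] using \<alpha>
          by (intro arg_cong2[where f = "(powr)"] refl) (simp add: field_simps)
        finally show ?thesis .
      qed
      finally show ?thesis .
    qed
    moreover have "c > 0"
      using C T \<delta> K by (simp add: c_def)
    ultimately show ?thesis by blast
  qed
  show "\<exists>\<epsilon>\<^sub>0>0. \<exists>c>0. \<forall>\<epsilon>. 0 < \<epsilon> \<and> \<epsilon> < \<epsilon>\<^sub>0 \<longrightarrow> ?P \<gamma> \<delta> \<epsilon> \<le> c * \<epsilon> powr (2 * (\<alpha> - \<mu>) / (1 - \<alpha>))"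
    if "\<delta> > 0" and "0 < \<gamma> \<and> \<gamma> < \<alpha> \<and> \<gamma> < \<mu> \<and> \<mu> < \<alpha>" for \<delta> \<gamma> \<mu>
  proof -
    obtain c where c: "c > 0" "\<And>\<epsilon>. 0 < \<epsilon> \<Longrightarrow> \<epsilon> < 1 \<Longrightarrow> ?P \<gamma> \<delta> \<epsilon> \<le> c * \<epsilon> powr (2 * (\<alpha> - \<gamma>) / (1 - \<alpha>))"
      using rate[OF \<open>\<delta> > 0\<close>, of \<gamma>] by blast
    have "?P \<gamma> \<delta> \<epsilon> \<le> c * \<epsilon> powr (2 * (\<alpha> - \<mu>) / (1 - \<alpha>))" if \<epsilon>: "0 < \<epsilon>" "\<epsilon> < 1" for \<epsilon>
    proof -
      \<comment> \<open>For \<epsilon> < 1 the smaller exponent, the one with \<mu> > \<gamma>,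
        gives the larger power.\<close>
      have "\<epsilon> powr (2 * (\<alpha> - \<gamma>) / (1 - \<alpha>)) \<le> \<epsilon> powr (2 * (\<alpha> - \<mu>) / (1 - \<alpha>))"
        using \<epsilon> \<alpha> \<open>_ \<and> _\<close> by (intro powr_mono') (auto intro!: divide_right_mono)
      then have "c * \<epsilon> powr (2 * (\<alpha> - \<gamma>) / (1 - \<alpha>)) \<le> c * \<epsilon> powr (2 * (\<alpha> - \<mu>) / (1 - \<alpha>))"
        using c(1) by (intro mult_left_mono) auto
      then show ?thesis
        using c(2)[OF \<epsilon>] by (rule order_trans[rotated])
    qed
    then show ?thesis using c(1) by (intro exI[of _ 1] exI[of _ c]) auto
  qed
  show "(?P \<gamma> \<delta> \<longlongrightarrow> 0) (at_right 0)" if "0 < \<gamma> \<and> \<gamma> < \<alpha>" and "\<delta> > 0" for \<gamma> \<delta>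
  proof -
    obtain c where c: "\<And>\<epsilon>. 0 < \<epsilon> \<Longrightarrow> \<epsilon> < 1 \<Longrightarrow> ?P \<gamma> \<delta> \<epsilon> \<le> c * \<epsilon> powr (2 * (\<alpha> - \<gamma>) / (1 - \<alpha>))"
      using rate[OF \<open>\<delta> > 0\<close>, of \<gamma>] by blast
    \<comment> \<open>The exponent is positive because \<gamma> < \<alpha> < 1, so the upper bound
      tends to 0 and squeezes the probabilities.\<close>
    have "((\<lambda>\<epsilon>. \<epsilon> powr (2 * (\<alpha> - \<gamma>) / (1 - \<alpha>))) \<longlongrightarrow> 0) (at_right 0)"
    proof (rule tendsto_zero_powrI[OF tendsto_ident_at tendsto_const])
      show "2 * (\<alpha> - \<gamma>) / (1 - \<alpha>) > 0" using \<alpha> that by simp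
      show "eventually (\<lambda>\<epsilon>::real. 0 \<le> \<epsilon>) (at_right 0)"
        using eventually_at_right_less[of "0::real"] by (rule eventually_mono) simp
    qed
    then have lim: "((\<lambda>\<epsilon>. c * \<epsilon> powr (2 * (\<alpha> - \<gamma>) / (1 - \<alpha>))) \<longlongrightarrow> 0) (at_right 0)"
      by (rule tendsto_mult_right_zero)
    have "eventually (\<lambda>\<epsilon>::real. \<epsilon> \<in> {0<..<1}) (at_right 0)"
      by (rule eventually_at_right_real) simp
    then have "eventually (\<lambda>\<epsilon>. ?P \<gamma> \<delta> \<epsilon> \<le> c * \<epsilon> powr (2 * (\<alpha> - \<gamma>) / (1 - \<alpha>))) (at_right 0)"
      by (rule eventually_mono) (use c in auto)
    then show ?thesis
      by (intro tendsto_sandwich[OF _ _ tendsto_const lim]) auto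
  qed
qed

end
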